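(* Let $(M,\mathfrak B,\mu)$ be a $\sigma$-finite measure space, $1\le p<+\infty$, and let $f\colon M\to M$ be a bijective bimeasurable map such that the Radon–Nikodym derivative $\frac{d\mu f}{d\mu}$ exists and is bounded from below (by a positive constant) and from above. Suppose there is $W\in\mathfrak B$ with $0<\mu(W)<+\infty$ such that $M$ is the disjoint union $M=\dot\bigcup_{k\in\mathbb Z}f^k(W)$. Then the dissipative composition operator $T_f\colon L^p(\mu)\to L^p(\mu)$, $T_f(\varphi)=\varphi\circ f$, is conjugate to the shift operator $\sigma_{\mathcal S}\colon\mathbf B\to\mathbf B$, where $$\mathbf B=\Big\{(\psi_n)_{n\in\mathbb Z}\in L^p(\mu|_W)^{\mathbb Z}\colon \sum_{n\in\mathbb Z}\int_W|\psi_n|^p\,\frac{d\mu f^n}{d\mu}\,d\mu<+\infty\Big\}$$ is endowed with the norm $$\|(\psi_n)_{n\in\mathbb Z}\|_{\mathbf B}=\Big(\sum_{n\in\mathbb Z}\int_W|\psi_n|^p\,\frac{d\mu f^n}{d\mu}\,d\mu\Big)^{1/p},$$ and $\mathcal S=(S_n)_{n\in\mathbb Z}$ with $S_n$ the identity map on $L^p(\mu|_W)$ for every $n\in\mathbb Z$.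
   Context: For $n\in\mathbb Z$, $\mu f^n$ denotes the measure $A\mapsto\mu(f^n(A))$, and $\frac{d\mu f^n}{d\mu}$ its Radon–Nikodym derivative with respect to $\mu$. Under the stated assumptions $T_f$ is a well-defined bounded invertible operator with $T_f^{-1}=T_{f^{-1}}$. Shift operator: given a Banach space $Y$, a sequence $\mathcal S=(S_n)_{n\in\mathbb Z}$ of bounded invertible linear operators on $Y$ with $\sup_n\max\{\|S_n\|,\|S_n^{-1}\|\}<\infty$, and a Banach space $\mathbf B\subset Y^{\mathbb Z}$, the shift operator $\sigma_{\mathcal S}\colon\mathbf B\to\mathbf B$ is the bounded invertible linear operator $\sigma_{\mathcal S}((x_n)_{n\in\mathbb Z})=(S_{n+1}(x_{n+1}))_{n\in\mathbb Z}$. Conjugate: bounded linear operators $T\colon X\to X$ and $R\colon Z\to Z$ on Banach spaces are conjugate if there is a bounded invertible linear operator (with bounded inverse) $H\colon X\to Z$ with $H\circ T=R\circ H$. *)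

theory Defs
  imports "HOL-Analysis.Analysis" "HOL-Algebra.Module"
begin

section \<open>Banach spaces with an explicit carrier\<close>

text \<open>
  The spaces below depend on a measure and an exponent, so they cannot be types. They are
  HOL-Algebra modules with a norm; the record fields for a ring multiplication, which a
  HOL-Algebra module carries but does not use, are left unspecified. The scalars form a type of
  sort {real_normed_field, banach, second_countable_topology}, which covers both the reals and
  the complex numbers.
\<close>

record ('k, 'v) normed_module = "('k, 'v) module" +
  vnorm :: "'v \<Rightarrow> real"

definition scalar_ring :: "'k::field ring" where
  "scalar_ring = \<lparr>carrier = UNIV, mult = (*), one = 1, zero = 0, add = (+)\<rparr>"

locale normed_space_on = Module.module scalar_ring X
  for X :: "('k::real_normed_field, 'v, 'm) normed_module_scheme" (structure) +
  assumes vnorm_nonneg: "x \<in> carrier X \<Longrightarrow> 0 \<le> vnorm X x"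
    and vnorm_eq_0: "x \<in> carrier X \<Longrightarrow> vnorm X x = 0 \<longleftrightarrow> x = \<zero>\<^bsub>X\<^esub>"
    and vnorm_triangle: "x \<in> carrier X \<Longrightarrow> y \<in> carrier X \<Longrightarrow>
      vnorm X (x \<oplus>\<^bsub>X\<^esub> y) \<le> vnorm X x + vnorm X y"
    and vnorm_smult: "x \<in> carrier X \<Longrightarrow> vnorm X (c \<odot>\<^bsub>X\<^esub> x) = norm c * vnorm X x"

locale banach_space_on = normed_space_on +
  assumes complete: "(\<And>n::nat. s n \<in> carrier X) \<Longrightarrow>
      (\<And>e. e > 0 \<Longrightarrow> \<exists>N. \<forall>m\<ge>N. \<forall>n\<ge>N. vnorm X (s m \<ominus>\<^bsub>X\<^esub> s n) < e) \<Longrightarrow>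
      \<exists>x\<in>carrier X. (\<lambda>n. vnorm X (s n \<ominus>\<^bsub>X\<^esub> x)) \<longlonglongrightarrow> 0"

definition bounded_linear_on ::
  "('k::real_normed_field, 'v) normed_module \<Rightarrow> ('k, 'w) normed_module \<Rightarrow> ('v \<Rightarrow> 'w) \<Rightarrow> bool" where
  "bounded_linear_on X Z T \<longleftrightarrow>
     (\<forall>x\<in>carrier X. T x \<in> carrier Z) \<and>
     (\<forall>x\<in>carrier X. \<forall>y\<in>carrier X. T (x \<oplus>\<^bsub>X\<^esub> y) = T x \<oplus>\<^bsub>Z\<^esub> T y) \<and>
     (\<forall>c. \<forall>x\<in>carrier X. T (c \<odot>\<^bsub>X\<^esub> x) = c \<odot>\<^bsub>Z\<^esub> T x) \<and>
     (\<exists>C. \<forall>x\<in>carrier X. vnorm Z (T x) \<le> C * vnorm X x)"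

text \<open>The standing requirements (Banach spaces, bounded linear operators) are part of the notion.\<close>

definition conjugate_operators ::
  "('k::real_normed_field, 'v) normed_module \<Rightarrow> ('v \<Rightarrow> 'v) \<Rightarrow>
   ('k, 'w) normed_module \<Rightarrow> ('w \<Rightarrow> 'w) \<Rightarrow> bool" where
  "conjugate_operators X T Z R \<longleftrightarrow>
     banach_space_on X \<and> banach_space_on Z \<and>
     bounded_linear_on X X T \<and> bounded_linear_on Z Z R \<and>
     (\<exists>H. bounded_linear_on X Z H \<and> bij_betw H (carrier X) (carrier Z) \<and>
          bounded_linear_on Z X (inv_into (carrier X) H) \<and>
          (\<forall>x\<in>carrier X. H (T x) = R (H x)))"


section \<open>The space \<open>L\<^sup>p(M)\<close>\<close>

definition Lp_fun :: "'a measure \<Rightarrow> real \<Rightarrow> ('a \<Rightarrow> 'k::{banach, second_countable_topology}) set" where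
  "Lp_fun M p = {u \<in> borel_measurable M. integrable M (\<lambda>x. norm (u x) powr p)}"

definition Lp_rel :: "'a measure \<Rightarrow> real \<Rightarrow> ('a \<Rightarrow> 'k::{banach, second_countable_topology}) rel" where
  "Lp_rel M p = {(u, v). u \<in> Lp_fun M p \<and> v \<in> Lp_fun M p \<and> (AE x in M. u x = v x)}"

definition Lp_class ::
  "'a measure \<Rightarrow> real \<Rightarrow> ('a \<Rightarrow> 'k::{banach, second_countable_topology}) \<Rightarrow> ('a \<Rightarrow> 'k) set" where
  "Lp_class M p u = Lp_rel M p `` {u}"

definition Lp_rep :: "('a \<Rightarrow> 'k) set \<Rightarrow> 'a \<Rightarrow> 'k" where
  "Lp_rep A = (SOME u. u \<in> A)"

definition Lp_space :: "'a measure \<Rightarrow> real \<Rightarrow>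
    ('k::{real_normed_field, banach, second_countable_topology}, ('a \<Rightarrow> 'k) set) normed_module" where
  "Lp_space M p =
    \<lparr>carrier = Lp_fun M p // Lp_rel M p,
     mult = undefined, one = undefined,
     zero = Lp_class M p (\<lambda>x. 0),
     add = (\<lambda>A B. Lp_class M p (\<lambda>x. Lp_rep A x + Lp_rep B x)),
     smult = (\<lambda>c A. Lp_class M p (\<lambda>x. c * Lp_rep A x)),
     vnorm = (\<lambda>A. (integral\<^sup>L M (\<lambda>x. norm (Lp_rep A x) powr p)) powr (1 / p))\<rparr>"


section \<open>Composition and shift operators\<close>

definition int_iterate :: "'a measure \<Rightarrow> ('a \<Rightarrow> 'a) \<Rightarrow> int \<Rightarrow> 'a \<Rightarrow> 'a" where
  "int_iterate M f n =
     (if n \<ge> 0 then f ^^ nat n else inv_into (space M) f ^^ nat (- n))"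

text \<open>The measure \<open>A \<mapsto> \<mu>(f\<^sup>n(A))\<close>.\<close>

definition iterate_measure :: "'a measure \<Rightarrow> ('a \<Rightarrow> 'a) \<Rightarrow> int \<Rightarrow> 'a measure" where
  "iterate_measure M f n =
     measure_of (space M) (sets M) (\<lambda>A. emeasure M (int_iterate M f n ` A))"

definition composition_op ::
  "'a measure \<Rightarrow> real \<Rightarrow> ('a \<Rightarrow> 'a) \<Rightarrow>
   ('a \<Rightarrow> 'k::{banach, second_countable_topology}) set \<Rightarrow> ('a \<Rightarrow> 'k) set" where
  "composition_op M p f A = Lp_class M p (Lp_rep A \<circ> f)"

definition shift_op :: "(int \<Rightarrow> 'y \<Rightarrow> 'y) \<Rightarrow> (int \<Rightarrow> 'y) \<Rightarrow> (int \<Rightarrow> 'y)" where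
  "shift_op S x = (\<lambda>n. S (n + 1) (x (n + 1)))"

text \<open>The sum of the series with nonnegative terms, with values in [0, \<open>\<infinity>\<close>].\<close>

definition B_sum ::
  "'a measure \<Rightarrow> real \<Rightarrow> ('a \<Rightarrow> 'a) \<Rightarrow> 'a set \<Rightarrow> (int \<Rightarrow> ('a \<Rightarrow> 'k::real_normed_vector) set) \<Rightarrow> ennreal" where
  "B_sum M p f W \<psi> =
     (\<Sum>\<^sub>\<infinity>n\<in>UNIV. \<integral>\<^sup>+x\<in>W. ennreal (norm (Lp_rep (\<psi> n) x) powr p)
                            * RN_deriv M (iterate_measure M f n) x \<partial>M)"

definition B_space :: "'a measure \<Rightarrow> real \<Rightarrow> ('a \<Rightarrow> 'a) \<Rightarrow> 'a set \<Rightarrow>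
    ('k::{real_normed_field, banach, second_countable_topology}, int \<Rightarrow> ('a \<Rightarrow> 'k) set) normed_module" where
  "B_space M p f W = (let Y = Lp_space (restrict_space M W) p in
    \<lparr>carrier = {\<psi>. (\<forall>n. \<psi> n \<in> carrier Y) \<and> B_sum M p f W \<psi> < \<infinity>},
     mult = undefined, one = undefined,
     zero = (\<lambda>n. \<zero>\<^bsub>Y\<^esub>),
     add = (\<lambda>\<psi> \<phi> n. \<psi> n \<oplus>\<^bsub>Y\<^esub> \<phi> n),
     smult = (\<lambda>c \<psi> n. c \<odot>\<^bsub>Y\<^esub> \<psi> n),
     vnorm = (\<lambda>\<psi>. enn2real (B_sum M p f W \<psi>) powr (1 / p))\<rparr>)"

end

theory Submission
  imports Defs
begin

text \<open>
  The images of \<open>W\<close> under the iterates of \<open>f\<close> partition the space, and \<open>f\<close> moves each of them to the next.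
  Hence a function \<open>\<phi>\<close> on the space is the same as the sequence of its restrictions to these
  images; parametrising the \<open>n\<close>-th image by \<open>W\<close> through the \<open>n\<close>-th iterate, this is the sequence with
  components \<open>\<phi> \<circ> f\<^sup>n\<close> on \<open>W\<close>. In these coordinates composition with \<open>f\<close> raises the index by one, so it is
  the shift.
  
  It remains to compare the norms. The substitution \<open>y = f\<^sup>n x\<close> gives
  \[ \int_{f^n W} |\phi|^p \, d\mu = \int_W |\phi \circ f^n|^p \, \frac{d \mu f^n}{d \mu} \, d\mu , \]
  and summing over \<open>n\<close> shows that the norm of \<open>\<phi>\<close> is the norm of its sequence in \<open>\<bold>B\<close>
  (\<open>Lp_energy_eq_infsum_W\<close>). So the map is isometric. It is onto because measurable pieces on the
  countably many images glue to a measurable function (\<open>glue_along_orbit\<close>).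
  
  The bounds on the derivative of \<open>\<mu> f\<close> enter through \<open>nn_integral_g_le\<close>: composition with any
  iterate enlarges integrals at most by a constant factor. This makes the composition operator bounded and
  independent of representatives, gives the derivatives of all \<open>\<mu> f\<^sup>n\<close>, and puts every component
  in \<open>L\<^sup>p\<close> over \<open>W\<close>.
  
  Conjugacy also asserts that both spaces are Banach spaces. For \<open>L\<^sup>p\<close> this is Minkowski's
  inequality together with the Riesz-Fischer theorem (\<open>banach_space_on_Lp_space\<close>). For \<open>\<bold>B\<close> it is
  transported through the isometry (\<open>conjugate_operators_of_isometry\<close>), and so is the boundedness of the
  shift.
\<close>

section \<open>Isometric transport of Banach spaces and operators\<close>

lemma scalar_ring_simps [simp]:
  "carrier scalar_ring = UNIV" "a \<otimes>\<^bsub>scalar_ring\<^esub> b = a * b" "\<one>\<^bsub>scalar_ring\<^esub> = 1"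
  "\<zero>\<^bsub>scalar_ring\<^esub> = 0" "a \<oplus>\<^bsub>scalar_ring\<^esub> b = a + b"
  by (simp_all add: scalar_ring_def)

lemma cring_scalar_ring: "cring scalar_ring"
proof (rule cringI)
  show "abelian_group (scalar_ring :: 'a ring)"
  proof (rule abelian_groupI)
    fix x :: 'a
    show "\<exists>y\<in>carrier scalar_ring. y \<oplus>\<^bsub>scalar_ring\<^esub> x = \<zero>\<^bsub>scalar_ring\<^esub>"
      by (auto intro: exI [of _ "- x"])
  qed (auto simp: algebra_simps)
  show "Group.comm_monoid (scalar_ring :: 'a ring)"
    by (rule comm_monoidI) auto
qed (auto simp: algebra_simps)

text \<open>
  An isometric linear bijection carries every axiom over. The point is that \<open>Z\<close> is only assumed to
  be a record with operations: for the weighted sequence space this avoids a separate proof of the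
  triangle inequality and of completeness.
\<close>
lemma banach_space_on_isometric_image:
  fixes X :: "('k::real_normed_field, 'v) normed_module"
    and Z :: "('k, 'w) normed_module"
  assumes X: "banach_space_on X"
    and bij: "bij_betw H (carrier X) (carrier Z)"
    and add: "\<And>x y. x \<in> carrier X \<Longrightarrow> y \<in> carrier X \<Longrightarrow> H (x \<oplus>\<^bsub>X\<^esub> y) = H x \<oplus>\<^bsub>Z\<^esub> H y"
    and smult: "\<And>c x. x \<in> carrier X \<Longrightarrow> H (c \<odot>\<^bsub>X\<^esub> x) = c \<odot>\<^bsub>Z\<^esub> H x"
    and zero: "H \<zero>\<^bsub>X\<^esub> = \<zero>\<^bsub>Z\<^esub>"
    and norm: "\<And>x. x \<in> carrier X \<Longrightarrow> vnorm Z (H x) = vnorm X x"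
  shows "banach_space_on Z"
proof -
  interpret X: banach_space_on X by (rule X)
  have mod: "module scalar_ring X" by (rule X.module_axioms)
  have H: "H x \<in> carrier Z" if "x \<in> carrier X" for x
    using bij that by (auto simp: bij_betw_def)
  have surj: "\<exists>x\<in>carrier X. z = H x" if "z \<in> carrier Z" for z
    using bij that by (auto simp: bij_betw_def)
  have inj: "H x = H y \<longleftrightarrow> x = y" if "x \<in> carrier X" "y \<in> carrier X" for x y
    using bij that by (auto simp: bij_betw_def inj_on_def)
  have sm: "c \<odot>\<^bsub>X\<^esub> x \<in> carrier X" if "x \<in> carrier X" for c x
    using that by (intro X.smult_closed) auto
  have grp: "abelian_group Z"
  proof (rule abelian_groupI)
    show "\<zero>\<^bsub>Z\<^esub> \<in> carrier Z" using H [OF X.zero_closed] zero by simp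
  next
    fix x y assume "x \<in> carrier Z" "y \<in> carrier Z"
    then obtain a b where "a \<in> carrier X" "b \<in> carrier X" "x = H a" "y = H b" by (metis surj)
    then show "x \<oplus>\<^bsub>Z\<^esub> y \<in> carrier Z" "x \<oplus>\<^bsub>Z\<^esub> y = y \<oplus>\<^bsub>Z\<^esub> x"
      using H by (simp_all add: add [symmetric] X.M.a_comm)
  next
    fix x y z assume "x \<in> carrier Z" "y \<in> carrier Z" "z \<in> carrier Z"
    then obtain a b c where "a \<in> carrier X" "b \<in> carrier X" "c \<in> carrier X"
      "x = H a" "y = H b" "z = H c" by (metis surj)
    then show "(x \<oplus>\<^bsub>Z\<^esub> y) \<oplus>\<^bsub>Z\<^esub> z = x \<oplus>\<^bsub>Z\<^esub> (y \<oplus>\<^bsub>Z\<^esub> z)"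
      by (simp add: add [symmetric] X.M.a_assoc)
  next
    fix x assume "x \<in> carrier Z"
    then obtain a where a: "a \<in> carrier X" "x = H a" by (metis surj)
    then show "\<zero>\<^bsub>Z\<^esub> \<oplus>\<^bsub>Z\<^esub> x = x"
      by (simp add: add [symmetric] zero [symmetric])
    have "H (\<ominus>\<^bsub>X\<^esub> a) \<oplus>\<^bsub>Z\<^esub> x = \<zero>\<^bsub>Z\<^esub>"
      using a by (simp add: add [symmetric] zero [symmetric] X.M.l_neg)
    then show "\<exists>y\<in>carrier Z. y \<oplus>\<^bsub>Z\<^esub> x = \<zero>\<^bsub>Z\<^esub>" using a H by blast
  qed
  interpret Z: abelian_group Z by (rule grp)
  \<comment> \<open>Completeness is phrased with differences, and additive inverses are given by a description operator.\<close>
  have diff: "H (x \<ominus>\<^bsub>X\<^esub> y) = H x \<ominus>\<^bsub>Z\<^esub> H y" if "x \<in> carrier X" "y \<in> carrier X" for x y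
  proof -
    have "H (\<ominus>\<^bsub>X\<^esub> y) \<oplus>\<^bsub>Z\<^esub> H y = \<zero>\<^bsub>Z\<^esub>"
      using that by (simp add: add [symmetric] zero [symmetric] X.M.l_neg)
    then have "\<ominus>\<^bsub>Z\<^esub> H y = H (\<ominus>\<^bsub>X\<^esub> y)"
      using that H by (intro Z.minus_equality) auto
    then show ?thesis using that by (simp add: a_minus_def add)
  qed
  show ?thesis
  proof (intro banach_space_on.intro normed_space_on.intro normed_space_on_axioms.intro
      banach_space_on_axioms.intro moduleI cring_scalar_ring grp)
    fix a :: 'k and x assume "x \<in> carrier Z"
    then obtain u where "u \<in> carrier X" "x = H u" by (metis surj)
    then show "a \<odot>\<^bsub>Z\<^esub> x \<in> carrier Z" "vnorm Z (a \<odot>\<^bsub>Z\<^esub> x) = norm a * vnorm Z x"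
      using H sm by (simp_all add: smult [symmetric] norm X.vnorm_smult)
  next
    fix a b :: 'k and x assume "x \<in> carrier Z"
    then obtain u where u: "u \<in> carrier X" "x = H u" by (metis surj)
    then show "(a \<oplus>\<^bsub>scalar_ring\<^esub> b) \<odot>\<^bsub>Z\<^esub> x = a \<odot>\<^bsub>Z\<^esub> x \<oplus>\<^bsub>Z\<^esub> b \<odot>\<^bsub>Z\<^esub> x"
      using sm X.smult_l_distr [of a b u] by (simp add: smult [symmetric] add [symmetric])
    show "(a \<otimes>\<^bsub>scalar_ring\<^esub> b) \<odot>\<^bsub>Z\<^esub> x = a \<odot>\<^bsub>Z\<^esub> (b \<odot>\<^bsub>Z\<^esub> x)"
      using u sm X.smult_assoc1 [of a b u] by (simp add: smult [symmetric])
  next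
    fix a :: 'k and x y assume "x \<in> carrier Z" "y \<in> carrier Z"
    then obtain u v where "u \<in> carrier X" "v \<in> carrier X" "x = H u" "y = H v" by (metis surj)
    then show "a \<odot>\<^bsub>Z\<^esub> (x \<oplus>\<^bsub>Z\<^esub> y) = a \<odot>\<^bsub>Z\<^esub> x \<oplus>\<^bsub>Z\<^esub> a \<odot>\<^bsub>Z\<^esub> y"
      using sm X.smult_r_distr [of a u v] by (simp add: smult [symmetric] add [symmetric])
  next
    fix x assume "x \<in> carrier Z"
    then obtain u where u: "u \<in> carrier X" "x = H u" by (metis surj)
    then show "\<one>\<^bsub>scalar_ring\<^esub> \<odot>\<^bsub>Z\<^esub> x = x"
      using X.smult_one [of u] by (simp add: smult [symmetric])
    show "0 \<le> vnorm Z x" using u by (simp add: norm X.vnorm_nonneg)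
    show "vnorm Z x = 0 \<longleftrightarrow> x = \<zero>\<^bsub>Z\<^esub>"
      using u by (simp add: norm X.vnorm_eq_0 zero [symmetric] inj)
  next
    fix x y assume "x \<in> carrier Z" "y \<in> carrier Z"
    then obtain u v where "u \<in> carrier X" "v \<in> carrier X" "x = H u" "y = H v" by (metis surj)
    then show "vnorm Z (x \<oplus>\<^bsub>Z\<^esub> y) \<le> vnorm Z x + vnorm Z y"
      by (simp add: add [symmetric] norm X.vnorm_triangle)
  next
    fix s :: "nat \<Rightarrow> 'w"
    assume s: "\<And>n. s n \<in> carrier Z"
      and Cauchy: "\<And>e. e > 0 \<Longrightarrow> \<exists>N. \<forall>m\<ge>N. \<forall>n\<ge>N. vnorm Z (s m \<ominus>\<^bsub>Z\<^esub> s n) < e"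
    have "\<forall>n. \<exists>x. x \<in> carrier X \<and> s n = H x" using surj s by blast
    then obtain t where t: "\<And>n. t n \<in> carrier X" "\<And>n. s n = H (t n)"
      by (auto dest!: choice)
    have *: "vnorm Z (H (t m) \<ominus>\<^bsub>Z\<^esub> H x) = vnorm X (t m \<ominus>\<^bsub>X\<^esub> x)" if "x \<in> carrier X" for m x
      using t that by (simp add: diff [symmetric] norm)
    have "\<exists>x\<in>carrier X. (\<lambda>n. vnorm X (t n \<ominus>\<^bsub>X\<^esub> x)) \<longlonglongrightarrow> 0"
    proof (rule X.complete)
      show "\<exists>N. \<forall>m\<ge>N. \<forall>n\<ge>N. vnorm X (t m \<ominus>\<^bsub>X\<^esub> t n) < e" if "e > 0" for e
        using Cauchy [OF that] t(1) by (simp add: * t(2))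
    qed (rule t)
    then obtain x where "x \<in> carrier X" "(\<lambda>n. vnorm X (t n \<ominus>\<^bsub>X\<^esub> x)) \<longlonglongrightarrow> 0" by blast
    then show "\<exists>z\<in>carrier Z. (\<lambda>n. vnorm Z (s n \<ominus>\<^bsub>Z\<^esub> z)) \<longlonglongrightarrow> 0"
      using H by (intro bexI [of _ "H x"]) (auto simp: * t(2))
  qed
qed

text \<open>
  Since \<open>R = H \<circ> T \<circ> H\<inverse>\<close> on \<open>carrier Z\<close>, the operator \<open>R\<close> inherits linearity and the bound of \<open>T\<close>.
\<close>
lemma conjugate_operators_of_isometry:
  fixes X :: "('k::real_normed_field, 'v) normed_module"
    and Z :: "('k, 'w) normed_module"
  assumes X: "banach_space_on X"
    and T: "bounded_linear_on X X T"
    and bij: "bij_betw H (carrier X) (carrier Z)"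
    and add: "\<And>x y. x \<in> carrier X \<Longrightarrow> y \<in> carrier X \<Longrightarrow> H (x \<oplus>\<^bsub>X\<^esub> y) = H x \<oplus>\<^bsub>Z\<^esub> H y"
    and smult: "\<And>c x. x \<in> carrier X \<Longrightarrow> H (c \<odot>\<^bsub>X\<^esub> x) = c \<odot>\<^bsub>Z\<^esub> H x"
    and zero: "H \<zero>\<^bsub>X\<^esub> = \<zero>\<^bsub>Z\<^esub>"
    and norm: "\<And>x. x \<in> carrier X \<Longrightarrow> vnorm Z (H x) = vnorm X x"
    and conj: "\<And>x. x \<in> carrier X \<Longrightarrow> H (T x) = R (H x)"
  shows "conjugate_operators X T Z R"
proof -
  interpret X: banach_space_on X by (rule X)
  let ?G = "inv_into (carrier X) H"
  have H: "H x \<in> carrier Z" if "x \<in> carrier X" for x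
    using bij that by (auto simp: bij_betw_def)
  have surj: "\<exists>x\<in>carrier X. z = H x" if "z \<in> carrier Z" for z
    using bij that by (auto simp: bij_betw_def)
  have G: "?G (H x) = x" if "x \<in> carrier X" for x
    using bij that by (simp add: bij_betw_def)
  have sm: "c \<odot>\<^bsub>X\<^esub> x \<in> carrier X" if "x \<in> carrier X" for c x
    using that by (intro X.smult_closed) auto
  have Tc: "T x \<in> carrier X" if "x \<in> carrier X" for x
    using T that by (simp add: bounded_linear_on_def)
  have Ta: "T (x \<oplus>\<^bsub>X\<^esub> y) = T x \<oplus>\<^bsub>X\<^esub> T y" if "x \<in> carrier X" "y \<in> carrier X" for x y
    using T that by (simp add: bounded_linear_on_def)
  have Ts: "T (c \<odot>\<^bsub>X\<^esub> x) = c \<odot>\<^bsub>X\<^esub> T x" if "x \<in> carrier X" for c x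
    using T that by (simp add: bounded_linear_on_def)
  obtain K where Tb: "\<And>x. x \<in> carrier X \<Longrightarrow> vnorm X (T x) \<le> K * vnorm X x"
    using T unfolding bounded_linear_on_def by blast
  have "bounded_linear_on X Z H"
    using H by (auto simp: bounded_linear_on_def add smult norm intro!: exI [of _ 1])
  moreover have "bounded_linear_on Z X ?G"
    unfolding bounded_linear_on_def
  proof (intro conjI ballI allI exI [of _ 1])
    fix z assume "z \<in> carrier Z"
    then obtain x where x: "x \<in> carrier X" "z = H x" by (metis surj)
    then show "?G z \<in> carrier X" "vnorm X (?G z) \<le> 1 * vnorm Z z" by (simp_all add: G norm)
    show "?G (c \<odot>\<^bsub>Z\<^esub> z) = c \<odot>\<^bsub>X\<^esub> ?G z" for c
      using x by (simp add: G sm flip: smult)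
    fix w assume "w \<in> carrier Z"
    then obtain y where "y \<in> carrier X" "w = H y" by (metis surj)
    then show "?G (z \<oplus>\<^bsub>Z\<^esub> w) = ?G z \<oplus>\<^bsub>X\<^esub> ?G w"
      using x by (simp add: G flip: add)
  qed
  moreover have "bounded_linear_on Z Z R"
    unfolding bounded_linear_on_def
  proof (intro conjI ballI allI exI [of _ K])
    fix z assume "z \<in> carrier Z"
    then obtain x where x: "x \<in> carrier X" "z = H x" by (metis surj)
    then show "R z \<in> carrier Z" "vnorm Z (R z) \<le> K * vnorm Z z"
      by (simp_all add: norm Tb Tc H flip: conj)
    show "R (c \<odot>\<^bsub>Z\<^esub> z) = c \<odot>\<^bsub>Z\<^esub> R z" for c
      using x by (simp add: sm Ts Tc flip: smult conj)
    fix w assume "w \<in> carrier Z"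
    then obtain y where "y \<in> carrier X" "w = H y" by (metis surj)
    then show "R (z \<oplus>\<^bsub>Z\<^esub> w) = R z \<oplus>\<^bsub>Z\<^esub> R w"
      using x by (simp add: Ta Tc flip: add conj)
  qed
  ultimately show ?thesis
    using X T bij conj banach_space_on_isometric_image [OF X bij add smult zero norm]
    unfolding conjugate_operators_def by blast
qed


section \<open>Minkowski inequality and completeness for \<open>p\<close>-integrable functions\<close>

text \<open>
  The \<open>p\<close>-th power of the norm, kept as an extended nonnegative integral so that Fatou's lemma,
  changes of variables and countable decompositions apply without integrability side conditions.
\<close>
definition Lp_energy :: "'a measure \<Rightarrow> real \<Rightarrow> ('a \<Rightarrow> 'k::real_normed_vector) \<Rightarrow> ennreal" where
  "Lp_energy M p u = (\<integral>\<^sup>+x. ennreal (norm (u x) powr p) \<partial>M)"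

definition Lp_norm :: "'a measure \<Rightarrow> real \<Rightarrow> ('a \<Rightarrow> 'k::real_normed_vector) \<Rightarrow> real" where
  "Lp_norm M p u = enn2real (Lp_energy M p u) powr (1 / p)"

lemma Lp_fun_iff:
  "u \<in> Lp_fun M p \<longleftrightarrow> u \<in> borel_measurable M \<and> Lp_energy M p u < \<infinity>"
  by (auto simp: Lp_fun_def Lp_energy_def integrable_iff_bounded)

lemma Lp_energy_cong_AE:
  "AE x in M. u x = v x \<Longrightarrow> Lp_energy M p u = Lp_energy M p v"
  unfolding Lp_energy_def by (rule nn_integral_cong_AE) auto

lemma Lp_norm_nonneg: "0 \<le> Lp_norm M p u"
  by (simp add: Lp_norm_def)

lemma Lp_norm_le_iff:
  assumes "Lp_energy M p u < \<infinity>" "0 < p" "0 \<le> e"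
  shows "Lp_norm M p u \<le> e \<longleftrightarrow> Lp_energy M p u \<le> ennreal (e powr p)"
proof -
  define E where "E = enn2real (Lp_energy M p u)"
  have E: "Lp_energy M p u = ennreal E" "0 \<le> E"
    using assms(1) by (simp_all add: E_def)
  have "E powr (1 / p) \<le> e \<longleftrightarrow> (E powr (1 / p)) powr p \<le> e powr p"
  proof
    assume "(E powr (1 / p)) powr p \<le> e powr p"
    then show "E powr (1 / p) \<le> e"
      using powr_less_mono2 [of p e "E powr (1 / p)"] assms by linarith
  qed (use assms in \<open>auto intro: powr_mono2\<close>)
  also have "(E powr (1 / p)) powr p = E"
    using assms E by (simp add: powr_powr)
  finally show ?thesis
    using E by (simp add: Lp_norm_def)
qed

lemma Lp_energy_scale:
  fixes u :: "'a \<Rightarrow> 'k::real_normed_div_algebra"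
  assumes "u \<in> borel_measurable M"
  shows "Lp_energy M p (\<lambda>x. c * u x) = ennreal (norm c powr p) * Lp_energy M p u"
  using assms by (simp add: Lp_energy_def norm_mult powr_mult ennreal_mult nn_integral_cmult)

lemma Lp_norm_scale:
  fixes u :: "'a \<Rightarrow> 'k::real_normed_div_algebra"
  assumes "u \<in> borel_measurable M" "0 < p"
  shows "Lp_norm M p (\<lambda>x. c * u x) = norm c * Lp_norm M p u"
  using assms by (simp add: Lp_norm_def Lp_energy_scale enn2real_mult powr_mult powr_powr)

lemma Lp_norm_eq_0_iff:
  assumes "u \<in> Lp_fun M p" "0 < p"
  shows "Lp_norm M p u = 0 \<longleftrightarrow> (AE x in M. u x = 0)"
proof -
  have "Lp_norm M p u = 0 \<longleftrightarrow> Lp_energy M p u = 0"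
    using assms by (auto simp: Lp_norm_def Lp_fun_iff enn2real_eq_0_iff)
  also have "\<dots> \<longleftrightarrow> (AE x in M. u x = 0)"
    using assms unfolding Lp_energy_def
    by (subst nn_integral_0_iff_AE) (auto simp: Lp_fun_iff)
  finally show ?thesis .
qed

text \<open>
  For positive arguments this is convexity of the power function; if one of them is \<open>0\<close>, the inequality
  reduces to \<open>t powr p \<le> t\<close> for \<open>0 \<le> t \<le> 1\<close>.
\<close>
lemma powr_convex_nonneg:
  fixes x y a b p :: real
  assumes "1 \<le> p" "0 \<le> x" "0 \<le> y" "0 \<le> a" "0 \<le> b" "a + b = 1"
  shows "(a * x + b * y) powr p \<le> a * x powr p + b * y powr p"
proof -
  have le: "t powr p \<le> t" if "0 \<le> t" "t \<le> 1" for t :: real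
    using that assms(1) powr_mono' [of 1 p t] by simp
  consider "x = 0" | "y = 0" | "0 < x" "0 < y" using assms by linarith
  then show ?thesis
  proof cases
    case 1
    then show ?thesis using assms le [of b] by (simp add: powr_mult mult_right_mono)
  next
    case 2
    then show ?thesis using assms le [of a] by (simp add: powr_mult mult_right_mono)
  next
    case 3
    have "convex_on {0<..} (\<lambda>t. t powr p)" by (rule powr_convex [OF assms(1)])
    then show ?thesis using 3 assms by (auto simp: convex_on_def)
  qed
qed

text \<open>
  Minkowski's inequality before integration: write \<open>s + t\<close> as \<open>a + b\<close> times the convex combination of
  \<open>s / a\<close> and \<open>t / b\<close> with weights \<open>a / (a + b)\<close> and \<open>b / (a + b)\<close>. When \<open>s\<close> and \<open>t\<close> are the absolute values
  of functions of norm at most \<open>a\<close> and \<open>b\<close>, the bracket integrates to at most \<open>1\<close>.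
\<close>
lemma powr_add_le_weighted:
  fixes s t a b p :: real
  assumes "1 \<le> p" "0 \<le> s" "0 \<le> t" "0 < a" "0 < b"
  shows "(s + t) powr p
    \<le> (a + b) powr p * (a / (a + b) / a powr p * s powr p + b / (a + b) / b powr p * t powr p)"
proof -
  have "s + t = (a + b) * (a / (a + b) * (s / a) + b / (a + b) * (t / b))"
  proof -
    have "(a + b) * (a / (a + b) * (s / a)) = s" "(a + b) * (b / (a + b) * (t / b)) = t"
      using assms by simp_all
    then show ?thesis by (simp add: distrib_left)
  qed
  then have "(s + t) powr p = (a + b) powr p * (a / (a + b) * (s / a) + b / (a + b) * (t / b)) powr p"
    using assms by (metis powr_mult)
  also have "\<dots> \<le> (a + b) powr p * (a / (a + b) * (s / a) powr p + b / (a + b) * (t / b) powr p)"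
    using assms by (intro mult_left_mono powr_convex_nonneg) (auto simp: add_divide_distrib [symmetric])
  finally show ?thesis using assms by (simp add: powr_divide)
qed

text \<open>
  Minkowski's inequality with upper bounds \<open>a\<close> and \<open>b\<close> in place of the norms. These may be taken
  positive, so functions of norm zero need no separate treatment.
\<close>
lemma Lp_energy_add_le:
  fixes u v :: "'a \<Rightarrow> 'k::{real_normed_vector, second_countable_topology}"
  assumes "1 \<le> p" "0 < a" "0 < b"
    and [measurable]: "u \<in> borel_measurable M" "v \<in> borel_measurable M"
    and u: "Lp_energy M p u \<le> ennreal (a powr p)" and v: "Lp_energy M p v \<le> ennreal (b powr p)"
  shows "Lp_energy M p (\<lambda>x. u x + v x) \<le> ennreal ((a + b) powr p)"
proof -
  define \<alpha> \<beta> \<gamma> where "\<alpha> = a / (a + b) / a powr p" and "\<beta> = b / (a + b) / b powr p"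
    and "\<gamma> = (a + b) powr p"
  have nn: "0 \<le> \<alpha>" "0 \<le> \<beta>" "0 \<le> \<gamma>" using assms by (auto simp: \<alpha>_def \<beta>_def \<gamma>_def)
  have "Lp_energy M p (\<lambda>x. u x + v x)
    \<le> (\<integral>\<^sup>+x. ennreal \<gamma> * (ennreal \<alpha> * ennreal (norm (u x) powr p) + ennreal \<beta> * ennreal (norm (v x) powr p)) \<partial>M)"
    unfolding Lp_energy_def
  proof (rule nn_integral_mono)
    fix x
    have "norm (u x + v x) powr p \<le> (norm (u x) + norm (v x)) powr p"
      using assms by (intro powr_mono2 norm_triangle_ineq) auto
    also have "\<dots> \<le> \<gamma> * (\<alpha> * norm (u x) powr p + \<beta> * norm (v x) powr p)"
      unfolding \<alpha>_def \<beta>_def \<gamma>_def using assms by (intro powr_add_le_weighted) auto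
    finally show "ennreal (norm (u x + v x) powr p)
      \<le> ennreal \<gamma> * (ennreal \<alpha> * ennreal (norm (u x) powr p) + ennreal \<beta> * ennreal (norm (v x) powr p))"
      using nn by (simp add: ennreal_mult [symmetric] ennreal_plus [symmetric] ennreal_leI del: ennreal_plus)
  qed
  also have "\<dots> = ennreal \<gamma> * (ennreal \<alpha> * Lp_energy M p u + ennreal \<beta> * Lp_energy M p v)"
    by (simp add: Lp_energy_def nn_integral_cmult nn_integral_add)
  also have "\<dots> \<le> ennreal \<gamma> * (ennreal \<alpha> * ennreal (a powr p) + ennreal \<beta> * ennreal (b powr p))"
    by (intro mult_left_mono add_mono u v) auto
  also have "\<dots> = ennreal (\<gamma> * (\<alpha> * a powr p + \<beta> * b powr p))"
    using nn by (simp add: ennreal_mult)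
  also have "\<alpha> * a powr p + \<beta> * b powr p = 1"
    using assms by (simp add: \<alpha>_def \<beta>_def add_divide_distrib [symmetric])
  finally show ?thesis by (simp add: \<gamma>_def)
qed

lemma Lp_energy_le_Lp_norm:
  assumes "Lp_energy M p u < \<infinity>" "0 < p" "Lp_norm M p u \<le> e"
  shows "Lp_energy M p u \<le> ennreal (e powr p)"
  using Lp_norm_le_iff [of M p u e] assms Lp_norm_nonneg [of M p u] by linarith

lemma Lp_fun_add:
  fixes u v :: "'a \<Rightarrow> 'k::{banach, second_countable_topology}"
  assumes p: "1 \<le> p" and u: "u \<in> Lp_fun M p" and v: "v \<in> Lp_fun M p"
  shows "(\<lambda>x. u x + v x) \<in> Lp_fun M p"
    and "Lp_norm M p (\<lambda>x. u x + v x) \<le> Lp_norm M p u + Lp_norm M p v"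
proof -
  have [measurable]: "u \<in> borel_measurable M" "v \<in> borel_measurable M"
    and fin: "Lp_energy M p u < \<infinity>" "Lp_energy M p v < \<infinity>"
    using u v by (auto simp: Lp_fun_iff)
  \<comment> \<open>The summand \<open>e\<close> makes both bounds positive.\<close>
  have le: "Lp_energy M p (\<lambda>x. u x + v x)
      \<le> ennreal ((Lp_norm M p u + e + (Lp_norm M p v + e)) powr p)" if "0 < e" for e
    using that p fin Lp_norm_nonneg [of M p u] Lp_norm_nonneg [of M p v]
    by (intro Lp_energy_add_le Lp_energy_le_Lp_norm) (auto intro: add_nonneg_pos)
  show mem: "(\<lambda>x. u x + v x) \<in> Lp_fun M p"
    using le [of 1] by (auto simp: Lp_fun_iff intro: le_less_trans)
  show "Lp_norm M p (\<lambda>x. u x + v x) \<le> Lp_norm M p u + Lp_norm M p v"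
  proof (rule field_le_epsilon)
    fix e :: real assume "0 < e"
    then have "Lp_energy M p (\<lambda>x. u x + v x)
      \<le> ennreal ((Lp_norm M p u + Lp_norm M p v + e) powr p)"
      using le [of "e / 2"] by (simp add: algebra_simps)
    then show "Lp_norm M p (\<lambda>x. u x + v x) \<le> Lp_norm M p u + Lp_norm M p v + e"
      using mem p \<open>0 < e\<close> by (subst Lp_norm_le_iff) (auto simp: Lp_fun_iff Lp_norm_nonneg)
  qed
qed

lemma Lp_fun_scale:
  fixes u :: "'a \<Rightarrow> 'k::{real_normed_field, banach, second_countable_topology}"
  assumes "u \<in> Lp_fun M p"
  shows "(\<lambda>x. c * u x) \<in> Lp_fun M p"
  using assms by (auto simp: Lp_fun_iff Lp_energy_scale ennreal_mult_less_top)

lemma Lp_fun_diff: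
  fixes u v :: "'a \<Rightarrow> 'k::{real_normed_field, banach, second_countable_topology}"
  assumes "1 \<le> p" "u \<in> Lp_fun M p" "v \<in> Lp_fun M p"
  shows "(\<lambda>x. u x - v x) \<in> Lp_fun M p"
  using Lp_fun_add(1) [OF assms(1,2) Lp_fun_scale [OF assms(3), of "-1"]] by simp

lemma Lp_fun_zero: "0 < p \<Longrightarrow> (\<lambda>x. 0) \<in> Lp_fun M p"
  by (simp add: Lp_fun_iff Lp_energy_def)

lemma convergent_if_geometric_steps:
  fixes a :: "nat \<Rightarrow> 'b::banach"
  assumes "\<forall>\<^sub>F k in sequentially. norm (a (Suc k) - a k) \<le> (1/2) ^ k"
  shows "convergent a"
proof -
  have "summable (\<lambda>k. norm (a (Suc k) - a k))"
    by (rule summable_comparison_test_ev [of _ "\<lambda>k. (1/2) ^ k"])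
       (use assms in \<open>auto elim: eventually_mono intro: summable_geometric\<close>)
  then have "summable (\<lambda>k. a (Suc k) - a k)" by (rule summable_norm_cancel)
  then obtain l where "(\<lambda>n. \<Sum>k<n. a (Suc k) - a k) \<longlonglongrightarrow> l"
    by (auto simp: summable_def sums_def)
  then have "(\<lambda>n. a n - a 0) \<longlonglongrightarrow> l" by (simp add: sum_lessThan_telescope)
  then have "(\<lambda>n. a n - a 0 + a 0) \<longlonglongrightarrow> l + a 0" by (intro tendsto_intros)
  then show ?thesis by (auto simp: convergent_def)
qed

text \<open>
  If the increments have \<open>L\<^sup>p\<close> norm at most \<open>4\<close> to the power \<open>-k\<close>, then even after multiplication by \<open>2\<close> to
  the power \<open>k\<close> their \<open>p\<close>-th powers have a summable sequence of integrals. Hence at almost every point these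
  \<open>p\<close>-th powers tend to \<open>0\<close>, and the increments are eventually below a convergent geometric series.
\<close>
lemma AE_convergent_if_Lp_fast:
  fixes w :: "nat \<Rightarrow> 'a \<Rightarrow> 'k::{real_normed_field, banach, second_countable_topology}"
  assumes p: "1 \<le> p" and w: "\<And>k. w k \<in> borel_measurable M"
    and fast: "\<And>k. Lp_energy M p (\<lambda>x. w (Suc k) x - w k x) \<le> ennreal (((1/4) ^ k) powr p)"
  shows "AE x in M. convergent (\<lambda>k. w k x)"
proof -
  note w [measurable]
  let ?d = "\<lambda>k x. w (Suc k) x - w k x"
  have "(\<integral>\<^sup>+x. (\<Sum>k. ennreal ((2 ^ k) powr p * norm (?d k x) powr p)) \<partial>M)
      = (\<Sum>k. ennreal ((2 ^ k) powr p) * Lp_energy M p (?d k))"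
    by (subst nn_integral_suminf) (simp_all add: Lp_energy_def ennreal_mult nn_integral_cmult)
  also have "\<dots> \<le> (\<Sum>k. ennreal ((1/2) ^ k))"
  proof (rule suminf_le)
    fix k
    have "ennreal ((2 ^ k) powr p) * Lp_energy M p (?d k)
        \<le> ennreal ((2 ^ k) powr p) * ennreal (((1/4) ^ k) powr p)"
      by (intro mult_left_mono fast) auto
    also have "\<dots> = ennreal (((1/2) ^ k) powr p)"
      by (simp add: ennreal_mult [symmetric] powr_mult [symmetric] power_mult_distrib [symmetric])
    also have "((1/2) ^ k) powr p \<le> (1/2::real) ^ k"
      using powr_mono' [of 1 p "(1/2) ^ k"] p by (simp add: power_le_one)
    finally show "ennreal ((2 ^ k) powr p) * Lp_energy M p (?d k) \<le> ennreal ((1/2) ^ k)"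
      by (simp add: ennreal_leI)
  qed auto
  also have "\<dots> < \<infinity>"
    by (subst suminf_ennreal2) (auto intro: summable_geometric)
  finally have "AE x in M. (\<Sum>k. ennreal ((2 ^ k) powr p * norm (?d k x) powr p)) \<noteq> \<infinity>"
    by (intro nn_integral_PInf_AE) auto
  then show ?thesis
  proof eventually_elim
    fix x assume "(\<Sum>k. ennreal ((2 ^ k) powr p * norm (?d k x) powr p)) \<noteq> \<infinity>"
    then have "summable (\<lambda>k. (2 ^ k) powr p * norm (?d k x) powr p)"
      by (intro summable_suminf_not_top) auto
    then have "\<forall>\<^sub>F k in sequentially. (2 ^ k) powr p * norm (?d k x) powr p < 1"
      by (intro order_tendstoD(2) [OF summable_LIMSEQ_zero]) auto
    then have "\<forall>\<^sub>F k in sequentially. norm (?d k x) \<le> (1/2) ^ k"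
    proof eventually_elim
      fix k assume "(2 ^ k) powr p * norm (?d k x) powr p < 1"
      then have "(2 ^ k * norm (?d k x)) powr p < 1 powr p" by (simp add: powr_mult)
      then have "2 ^ k * norm (?d k x) < 1"
        using p powr_mono2 [of p 1 "2 ^ k * norm (?d k x)"] by linarith
      then show "norm (?d k x) \<le> (1/2) ^ k" by (simp add: field_simps)
    qed
    then show "convergent (\<lambda>k. w k x)" by (rule convergent_if_geometric_steps)
  qed
qed

lemma Cauchy_fast_subsequence:
  fixes d :: "nat \<Rightarrow> nat \<Rightarrow> real"
  assumes "\<And>e. e > 0 \<Longrightarrow> \<exists>N. \<forall>m\<ge>N. \<forall>n\<ge>N. d m n < e" "\<And>k. 0 < \<epsilon> k"
  obtains r where "strict_mono r" "\<And>k. d (r (Suc k)) (r k) < \<epsilon> k"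
proof -
  have "\<forall>k. \<exists>N. \<forall>m\<ge>N. \<forall>n\<ge>N. d m n < \<epsilon> k" using assms by blast
  then obtain N where N: "\<And>k m n. m \<ge> N k \<Longrightarrow> n \<ge> N k \<Longrightarrow> d m n < \<epsilon> k" by metis
  \<comment> \<open>The partial sum dominates \<open>N k\<close>; the summand \<open>k\<close> makes \<open>r\<close> strictly increasing.\<close>
  define r where "r k = (\<Sum>i\<le>k. N i) + k" for k
  have "strict_mono r" by (auto simp: strict_mono_Suc_iff r_def)
  moreover have "N k \<le> r k" for k by (simp add: r_def trans_le_add1 member_le_sum)
  then have "d (r (Suc k)) (r k) < \<epsilon> k" for k
    using strict_monoD [OF \<open>strict_mono r\<close>, of k "Suc k"] by (intro N) (auto intro: order_trans less_imp_le)
  ultimately show ?thesis using that by blast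
qed

text \<open>
  A rapidly converging subsequence has an almost everywhere limit \<open>v\<close>; Fatou's lemma applied to
  \<open>\<bar>u n - u (r k)\<bar>\<close> as \<open>k\<close> grows turns the Cauchy bound into a bound for \<open>u n - v\<close>.
\<close>
theorem Riesz_Fischer:
  fixes u :: "nat \<Rightarrow> 'a \<Rightarrow> 'k::{real_normed_field, banach, second_countable_topology}"
  assumes p: "1 \<le> p" and u: "\<And>n. u n \<in> Lp_fun M p"
    and Cauchy: "\<And>e. e > 0 \<Longrightarrow> \<exists>N. \<forall>m\<ge>N. \<forall>n\<ge>N. Lp_norm M p (\<lambda>x. u m x - u n x) < e"
  obtains v where "v \<in> Lp_fun M p" "(\<lambda>n. Lp_norm M p (\<lambda>x. u n x - v x)) \<longlonglongrightarrow> 0"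
proof -
  have um [measurable]: "u n \<in> borel_measurable M" for n using u by (auto simp: Lp_fun_iff)
  have en: "Lp_energy M p (\<lambda>x. u m x - u n x) \<le> ennreal (e powr p)"
    if "Lp_norm M p (\<lambda>x. u m x - u n x) < e" for m n e
    using that p Lp_fun_diff [OF p u u] by (intro Lp_energy_le_Lp_norm) (auto simp: Lp_fun_iff)
  obtain r where r: "strict_mono r"
    and fast: "\<And>k. Lp_norm M p (\<lambda>x. u (r (Suc k)) x - u (r k) x) < (1/4) ^ k"
    using Cauchy_fast_subsequence [OF Cauchy, of "\<lambda>k. (1/4) ^ k"] by auto
  define v where "v x = lim (\<lambda>k. u (r k) x)" for x
  have vm [measurable]: "v \<in> borel_measurable M" unfolding v_def [abs_def] by measurable
  have "AE x in M. convergent (\<lambda>k. u (r k) x)"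
    by (rule AE_convergent_if_Lp_fast [OF p um en [OF fast]])
  then have conv: "AE x in M. (\<lambda>k. u (r k) x) \<longlonglongrightarrow> v x"
    by eventually_elim (simp add: v_def convergent_LIMSEQ_iff)
  have lim: "\<exists>N. \<forall>n\<ge>N. Lp_energy M p (\<lambda>x. u n x - v x) \<le> ennreal (e powr p)" if "e > 0" for e
  proof -
    obtain N where N: "\<And>m n. m \<ge> N \<Longrightarrow> n \<ge> N \<Longrightarrow> Lp_norm M p (\<lambda>x. u m x - u n x) < e"
      using Cauchy [OF \<open>e > 0\<close>] by blast
    have "Lp_energy M p (\<lambda>x. u n x - v x) \<le> ennreal (e powr p)" if "n \<ge> N" for n
    proof -
      have "AE x in M. ennreal (norm (u n x - v x) powr p)
          = liminf (\<lambda>k. ennreal (norm (u n x - u (r k) x) powr p))"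
        using conv
      proof eventually_elim
        fix x assume "(\<lambda>k. u (r k) x) \<longlonglongrightarrow> v x"
        then have "(\<lambda>k. ennreal (norm (u n x - u (r k) x) powr p))
            \<longlonglongrightarrow> ennreal (norm (u n x - v x) powr p)"
          using p by (intro tendsto_ennrealI tendsto_powr2 tendsto_intros) auto
        then show "ennreal (norm (u n x - v x) powr p)
            = liminf (\<lambda>k. ennreal (norm (u n x - u (r k) x) powr p))"
          by (intro lim_imp_Liminf [symmetric]) auto
      qed
      then have "Lp_energy M p (\<lambda>x. u n x - v x)
          = (\<integral>\<^sup>+x. liminf (\<lambda>k. ennreal (norm (u n x - u (r k) x) powr p)) \<partial>M)"
        unfolding Lp_energy_def by (rule nn_integral_cong_AE)
      also have "\<dots> \<le> liminf (\<lambda>k. Lp_energy M p (\<lambda>x. u n x - u (r k) x))"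
        unfolding Lp_energy_def by (rule nn_integral_liminf) auto
      also have "\<dots> \<le> ennreal (e powr p)"
      proof (rule Liminf_le)
        have "r k \<ge> N" if "k \<ge> N" for k using seq_suble [OF r, of k] that by linarith
        then show "\<forall>\<^sub>F k in sequentially. Lp_energy M p (\<lambda>x. u n x - u (r k) x) \<le> ennreal (e powr p)"
          using N \<open>n \<ge> N\<close> by (intro eventually_sequentiallyI [of N] en) auto
      qed auto
      finally show ?thesis .
    qed
    then show ?thesis by blast
  qed
  have diff: "(\<lambda>x. u n x - v x) \<in> Lp_fun M p"
    if "Lp_energy M p (\<lambda>x. u n x - v x) \<le> ennreal (e powr p)" for n e
    using that by (auto simp: Lp_fun_iff intro: le_less_trans)
  obtain n where "Lp_energy M p (\<lambda>x. u n x - v x) \<le> ennreal (1 powr p)"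
    using lim [of 1] by auto
  then have "v \<in> Lp_fun M p"
    using Lp_fun_diff [OF p u [of n] diff, of n 1] by simp
  moreover have "(\<lambda>n. Lp_norm M p (\<lambda>x. u n x - v x)) \<longlonglongrightarrow> 0"
  proof (rule LIMSEQ_I)
    fix e :: real assume "0 < e"
    obtain N where N: "\<And>n. n \<ge> N \<Longrightarrow> Lp_energy M p (\<lambda>x. u n x - v x) \<le> ennreal ((e / 2) powr p)"
      using lim [of "e / 2"] \<open>0 < e\<close> by auto
    have "norm (Lp_norm M p (\<lambda>x. u n x - v x) - 0) < e" if "n \<ge> N" for n
    proof -
      have "Lp_norm M p (\<lambda>x. u n x - v x) \<le> e / 2"
        using diff [OF N [OF that]] N [OF that] p \<open>0 < e\<close>
        by (subst Lp_norm_le_iff) (auto simp: Lp_fun_iff)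
      then show ?thesis using \<open>0 < e\<close> by (simp add: Lp_norm_nonneg)
    qed
    then show "\<exists>N. \<forall>n\<ge>N. norm (Lp_norm M p (\<lambda>x. u n x - v x) - 0) < e" by blast
  qed
  ultimately show ?thesis using that by blast
qed


section \<open>The Banach space of classes of \<open>p\<close>-integrable functions\<close>

lemma equiv_Lp_rel: "equiv (Lp_fun M p) (Lp_rel M p)"
proof (rule equivI)
  show "refl_on (Lp_fun M p) (Lp_rel M p)" by (auto simp: refl_on_def Lp_rel_def)
  show "sym (Lp_rel M p)" by (auto simp: sym_def Lp_rel_def)
  show "trans (Lp_rel M p)" by (auto simp: trans_def Lp_rel_def)
qed (auto simp: Lp_rel_def)

lemma Lp_class_eq_iff:
  assumes "u \<in> Lp_fun M p" "v \<in> Lp_fun M p"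
  shows "Lp_class M p u = Lp_class M p v \<longleftrightarrow> (AE x in M. u x = v x)"
  using eq_equiv_class_iff [OF equiv_Lp_rel assms] assms
  by (simp add: Lp_class_def Lp_rel_def)

lemma Lp_class_in_carrier: "u \<in> Lp_fun M p \<Longrightarrow> Lp_class M p u \<in> carrier (Lp_space M p)"
  by (simp add: Lp_space_def Lp_class_def quotientI)

lemma
  assumes "u \<in> Lp_fun M p"
  shows Lp_rep_class_mem: "Lp_rep (Lp_class M p u) \<in> Lp_fun M p"
    and Lp_rep_class_AE: "AE x in M. Lp_rep (Lp_class M p u) x = u x"
proof -
  have "u \<in> Lp_class M p u" using assms by (simp add: Lp_class_def Lp_rel_def)
  then have "Lp_rep (Lp_class M p u) \<in> Lp_class M p u" unfolding Lp_rep_def by (rule someI [where P = "\<lambda>v. v \<in> Lp_class M p u"])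
  then have *: "Lp_rep (Lp_class M p u) \<in> Lp_fun M p"
    "AE x in M. u x = Lp_rep (Lp_class M p u) x"
    by (auto simp: Lp_class_def Lp_rel_def)
  show "Lp_rep (Lp_class M p u) \<in> Lp_fun M p" by fact
  show "AE x in M. Lp_rep (Lp_class M p u) x = u x" using *(2) by eventually_elim simp
qed

lemma Lp_space_carrierE:
  assumes "A \<in> carrier (Lp_space M p)"
  obtains u where "u \<in> Lp_fun M p" "A = Lp_class M p u"
  using assms by (auto simp: Lp_space_def Lp_class_def quotient_def)

lemma Lp_space_zero: "\<zero>\<^bsub>Lp_space M p\<^esub> = Lp_class M p (\<lambda>x. 0)"
  by (simp add: Lp_space_def)

lemma Lp_space_add:
  fixes u v :: "'a \<Rightarrow> 'k::{real_normed_field, banach, second_countable_topology}"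
  assumes "1 \<le> p" "u \<in> Lp_fun M p" "v \<in> Lp_fun M p"
  shows "Lp_class M p u \<oplus>\<^bsub>Lp_space M p\<^esub> Lp_class M p v = Lp_class M p (\<lambda>x. u x + v x)"
  using Lp_rep_class_AE [OF assms(2)] Lp_rep_class_AE [OF assms(3)]
  by (auto simp: Lp_space_def Lp_class_eq_iff Lp_fun_add Lp_rep_class_mem assms)

lemma Lp_space_smult:
  fixes u :: "'a \<Rightarrow> 'k::{real_normed_field, banach, second_countable_topology}"
  assumes "u \<in> Lp_fun M p"
  shows "c \<odot>\<^bsub>Lp_space M p\<^esub> Lp_class M p u = Lp_class M p (\<lambda>x. c * u x)"
  using Lp_rep_class_AE [OF assms]
  by (auto simp: Lp_space_def Lp_class_eq_iff Lp_fun_scale Lp_rep_class_mem assms)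

lemma Lp_space_vnorm:
  fixes u :: "'a \<Rightarrow> 'k::{real_normed_field, banach, second_countable_topology}"
  assumes "u \<in> Lp_fun M p"
  shows "vnorm (Lp_space M p) (Lp_class M p u) = Lp_norm M p u"
proof -
  let ?v = "Lp_rep (Lp_class M p u)"
  have [measurable]: "?v \<in> borel_measurable M"
    using Lp_rep_class_mem [OF assms] by (auto simp: Lp_fun_iff)
  have "vnorm (Lp_space M p) (Lp_class M p u) = Lp_norm M p ?v"
    by (simp add: Lp_space_def Lp_norm_def Lp_energy_def integral_eq_nn_integral)
  also have "\<dots> = Lp_norm M p u"
    unfolding Lp_norm_def by (simp add: Lp_energy_cong_AE [OF Lp_rep_class_AE [OF assms]])
  finally show ?thesis .
qed

text \<open>
  Once the operations are expressed on representatives, the algebraic axioms are pointwise identities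
  and the analytic ones are Minkowski's inequality and the Riesz-Fischer theorem.
\<close>
theorem banach_space_on_Lp_space:
  assumes p: "1 \<le> p"
  shows "banach_space_on (Lp_space M p ::
    ('k::{real_normed_field, banach, second_countable_topology}, ('a \<Rightarrow> 'k) set) normed_module)"
    (is "banach_space_on ?L")
proof -
  note Lp_simps = Lp_space_zero Lp_space_add [OF p] Lp_space_smult Lp_space_vnorm
    Lp_class_in_carrier Lp_fun_add(1) [OF p] Lp_fun_scale Lp_fun_zero
  have p0: "0 < p" using p by simp
  have grp: "abelian_group ?L"
  proof (rule abelian_groupI)
    show "\<zero>\<^bsub>?L\<^esub> \<in> carrier ?L" using p0 by (simp add: Lp_simps)
  next
    fix x y assume "x \<in> carrier ?L" "y \<in> carrier ?L"
    then show "x \<oplus>\<^bsub>?L\<^esub> y \<in> carrier ?L" "x \<oplus>\<^bsub>?L\<^esub> y = y \<oplus>\<^bsub>?L\<^esub> x"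
      by (auto elim!: Lp_space_carrierE simp: Lp_simps add.commute)
  next
    fix x y z assume "x \<in> carrier ?L" "y \<in> carrier ?L" "z \<in> carrier ?L"
    then show "(x \<oplus>\<^bsub>?L\<^esub> y) \<oplus>\<^bsub>?L\<^esub> z = x \<oplus>\<^bsub>?L\<^esub> (y \<oplus>\<^bsub>?L\<^esub> z)"
      by (auto elim!: Lp_space_carrierE simp: Lp_simps add.assoc)
  next
    fix x assume "x \<in> carrier ?L"
    then obtain u where u: "u \<in> Lp_fun M p" "x = Lp_class M p u" by (rule Lp_space_carrierE)
    then show "\<zero>\<^bsub>?L\<^esub> \<oplus>\<^bsub>?L\<^esub> x = x" using p0 by (simp add: Lp_simps)
    have "Lp_class M p (\<lambda>x. - 1 * u x) \<oplus>\<^bsub>?L\<^esub> x = \<zero>\<^bsub>?L\<^esub>"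
      using u Lp_fun_scale [OF u(1), of "-1"] by (simp add: Lp_simps)
    then show "\<exists>y\<in>carrier ?L. y \<oplus>\<^bsub>?L\<^esub> x = \<zero>\<^bsub>?L\<^esub>"
      using Lp_class_in_carrier [OF Lp_fun_scale [OF u(1)]] by blast
  qed
  interpret abelian_group ?L by (rule grp)
  have minus: "Lp_class M p u \<ominus>\<^bsub>?L\<^esub> Lp_class M p v = Lp_class M p (\<lambda>x. u x - v x)"
    if "u \<in> Lp_fun M p" "v \<in> Lp_fun M p" for u v :: "'a \<Rightarrow> 'k"
  proof -
    have m: "(\<lambda>x. - v x) \<in> Lp_fun M p" using Lp_fun_scale [OF that(2), of "-1"] by simp
    have "\<ominus>\<^bsub>?L\<^esub> Lp_class M p v = Lp_class M p (\<lambda>x. - v x)"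
      using that m by (intro minus_equality) (simp_all add: Lp_simps)
    then show ?thesis using that m by (simp add: a_minus_def Lp_simps)
  qed
  show ?thesis
  proof (intro banach_space_on.intro normed_space_on.intro normed_space_on_axioms.intro
      banach_space_on_axioms.intro moduleI cring_scalar_ring grp)
    fix a :: 'k and x assume "x \<in> carrier ?L"
    then obtain u where u: "u \<in> Lp_fun M p" "x = Lp_class M p u" by (rule Lp_space_carrierE)
    then have "u \<in> borel_measurable M" by (simp add: Lp_fun_iff)
    then show "a \<odot>\<^bsub>?L\<^esub> x \<in> carrier ?L" "vnorm ?L (a \<odot>\<^bsub>?L\<^esub> x) = norm a * vnorm ?L x"
      using u p0 by (simp_all add: Lp_simps Lp_norm_scale)
  next
    fix a b :: 'k and x assume "x \<in> carrier ?L"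
    then show "(a \<oplus>\<^bsub>scalar_ring\<^esub> b) \<odot>\<^bsub>?L\<^esub> x = a \<odot>\<^bsub>?L\<^esub> x \<oplus>\<^bsub>?L\<^esub> b \<odot>\<^bsub>?L\<^esub> x"
      "(a \<otimes>\<^bsub>scalar_ring\<^esub> b) \<odot>\<^bsub>?L\<^esub> x = a \<odot>\<^bsub>?L\<^esub> (b \<odot>\<^bsub>?L\<^esub> x)"
      by (auto elim!: Lp_space_carrierE simp: Lp_simps distrib_right mult.assoc)
  next
    fix a :: 'k and x y assume "x \<in> carrier ?L" "y \<in> carrier ?L"
    then show "a \<odot>\<^bsub>?L\<^esub> (x \<oplus>\<^bsub>?L\<^esub> y) = a \<odot>\<^bsub>?L\<^esub> x \<oplus>\<^bsub>?L\<^esub> a \<odot>\<^bsub>?L\<^esub> y"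
      by (auto elim!: Lp_space_carrierE simp: Lp_simps distrib_left)
  next
    fix x assume "x \<in> carrier ?L"
    then obtain u where "u \<in> Lp_fun M p" "x = Lp_class M p u" by (rule Lp_space_carrierE)
    then show "\<one>\<^bsub>scalar_ring\<^esub> \<odot>\<^bsub>?L\<^esub> x = x" "0 \<le> vnorm ?L x"
      "vnorm ?L x = 0 \<longleftrightarrow> x = \<zero>\<^bsub>?L\<^esub>"
      using p0 by (simp_all add: Lp_simps Lp_norm_nonneg Lp_norm_eq_0_iff Lp_class_eq_iff)
  next
    fix x y assume "x \<in> carrier ?L" "y \<in> carrier ?L"
    then show "vnorm ?L (x \<oplus>\<^bsub>?L\<^esub> y) \<le> vnorm ?L x + vnorm ?L y"
      by (auto elim!: Lp_space_carrierE simp: Lp_simps Lp_fun_add(2) [OF p])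
  next
    fix s :: "nat \<Rightarrow> ('a \<Rightarrow> 'k) set"
    assume s: "\<And>n. s n \<in> carrier ?L"
      and Cauchy: "\<And>e. e > 0 \<Longrightarrow> \<exists>N. \<forall>m\<ge>N. \<forall>n\<ge>N. vnorm ?L (s m \<ominus>\<^bsub>?L\<^esub> s n) < e"
    have "\<forall>n. \<exists>u. u \<in> Lp_fun M p \<and> s n = Lp_class M p u" using s Lp_space_carrierE by metis
    then obtain u where u: "\<And>n. u n \<in> Lp_fun M p" "\<And>n. s n = Lp_class M p (u n)"
      by (auto dest!: choice)
    have norm: "vnorm ?L (s n \<ominus>\<^bsub>?L\<^esub> Lp_class M p v) = Lp_norm M p (\<lambda>x. u n x - v x)"
      if "v \<in> Lp_fun M p" for n v
      using u(1) [of n] that by (simp add: u(2) minus Lp_space_vnorm Lp_fun_diff [OF p])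
    obtain v where "v \<in> Lp_fun M p" "(\<lambda>n. Lp_norm M p (\<lambda>x. u n x - v x)) \<longlonglongrightarrow> 0"
    proof (rule Riesz_Fischer [OF p u(1)])
      show "\<exists>N. \<forall>m\<ge>N. \<forall>n\<ge>N. Lp_norm M p (\<lambda>x. u m x - u n x) < e" if "e > 0" for e
        using Cauchy [OF that] norm [OF u(1)] by (simp add: u(2) [symmetric])
    qed
    then show "\<exists>x\<in>carrier ?L. (\<lambda>n. vnorm ?L (s n \<ominus>\<^bsub>?L\<^esub> x)) \<longlonglongrightarrow> 0"
      by (intro bexI [of _ "Lp_class M p v"]) (simp_all add: norm Lp_class_in_carrier)
  qed
qed


section \<open>Dissipative systems\<close>

text \<open>
  A nonsingular invertible system in which the images of the single set \<open>W\<close> under all iterates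
  partition the space.
\<close>
locale dissipative_system = sigma_finite_measure M
  for M :: "'a measure" +
  fixes f :: "'a \<Rightarrow> 'a" and W :: "'a set" and c C :: real
  assumes bij: "bij_betw f (space M) (space M)"
    and f_measurable [measurable]: "f \<in> measurable M M"
    and f_image: "A \<in> sets M \<Longrightarrow> f ` A \<in> sets M"
    and density_exists: "\<exists>h \<in> borel_measurable M. density M h = iterate_measure M f 1"
    and c_pos: "0 < c"
    and RN_bounds: "AE x in M. ennreal c \<le> RN_deriv M (iterate_measure M f 1) x
                  \<and> RN_deriv M (iterate_measure M f 1) x \<le> ennreal C"
    and W [measurable]: "W \<in> sets M"
    and disjoint: "disjoint_family (\<lambda>k::int. int_iterate M f k ` W)"
    and cover: "(\<Union>k::int. int_iterate M f k ` W) = space M"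
begin

abbreviation "finv \<equiv> inv_into (space M) f"
abbreviation "g \<equiv> int_iterate M f"
abbreviation "RN n \<equiv> RN_deriv M (iterate_measure M f n)"
abbreviation "M\<^sub>W \<equiv> restrict_space M W"

lemma f_closed: "x \<in> space M \<Longrightarrow> f x \<in> space M"
  using f_measurable by (rule measurable_space)

lemma finv_f: "x \<in> space M \<Longrightarrow> finv (f x) = x"
  using bij by (simp add: bij_betw_def)

lemma f_finv: "x \<in> space M \<Longrightarrow> f (finv x) = x"
  using bij by (simp add: bij_betw_def f_inv_into_f)

lemma finv_closed: "x \<in> space M \<Longrightarrow> finv x \<in> space M"
  using bij inv_into_into [of x f "space M"] by (simp add: bij_betw_def)

lemma finv_measurable [measurable]: "finv \<in> measurable M M"
proof (rule measurableI)
  fix A assume A: "A \<in> sets M"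
  have "finv -` A \<inter> space M = f ` A"
    using sets.sets_into_space [OF A] f_closed finv_f f_finv by (force simp: image_iff)
  then show "finv -` A \<inter> space M \<in> sets M" using f_image [OF A] by simp
qed (rule finv_closed)

lemma g_of_nat: "g (int k) = f ^^ k" and g_of_neg: "g (- int k) = finv ^^ k"
  by (auto simp: int_iterate_def fun_eq_iff)

lemma g_0: "g 0 x = x"
  by (simp add: int_iterate_def)

lemma g_1: "g 1 = f"
  by (simp add: int_iterate_def)

lemma g_measurable [measurable]: "g n \<in> measurable M M"
proof -
  have pow: "h ^^ k \<in> measurable M M" if "h \<in> measurable M M" for h :: "'a \<Rightarrow> 'a" and k
    using that by (induction k) (auto simp: id_def intro: measurable_comp)
  show ?thesis by (cases n rule: int_cases2) (simp_all add: g_of_nat g_of_neg pow)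
qed

lemma g_closed: "x \<in> space M \<Longrightarrow> g n x \<in> space M"
  using g_measurable by (rule measurable_space)

lemma g_succ: "x \<in> space M \<Longrightarrow> g (n + 1) x = f (g n x)"
proof (cases n rule: int_cases)
  case (nonneg k)
  then have "n + 1 = int (Suc k)" by simp
  then show ?thesis using nonneg by (simp only: g_of_nat) simp
next
  case (neg k)
  assume x: "x \<in> space M"
  have "n + 1 = - int k" using neg by simp
  moreover have "(finv ^^ k) x \<in> space M" using g_closed [OF x, of "- int k"] by (simp add: g_of_neg)
  ultimately show ?thesis using neg by (simp only: g_of_neg) (simp add: f_finv)
qed

lemma g_pred: "x \<in> space M \<Longrightarrow> g (n - 1) x = finv (g n x)"
  using g_succ [of x "n - 1"] by (simp add: finv_f g_closed)

lemma g_add: "x \<in> space M \<Longrightarrow> g (m + n) x = g m (g n x)"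
proof (induction m rule: int_induct [where k = 0])
  case base
  then show ?case by (simp add: g_0)
next
  case (step1 i)
  then show ?case using g_succ [of x "i + n"] g_succ [of "g n x" i] by (simp add: g_closed ac_simps)
next
  case (step2 i)
  then show ?case using g_pred [of x "i + n"] g_pred [of "g n x" i] by (simp add: g_closed algebra_simps)
qed

lemma g_inverse: "x \<in> space M \<Longrightarrow> g n (g (- n) x) = x" "x \<in> space M \<Longrightarrow> g (- n) (g n x) = x"
  by (simp_all add: g_add [symmetric] g_0)

lemma g_image_eq_vimage: "A \<subseteq> space M \<Longrightarrow> g n ` A = g (- n) -` A \<inter> space M"
proof (intro equalityI subsetI)
  fix x assume "A \<subseteq> space M" "x \<in> g (- n) -` A \<inter> space M"
  then show "x \<in> g n ` A" by (intro image_eqI [of _ _ "g (- n) x"]) (auto simp: g_inverse)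
qed (auto simp: g_inverse intro: g_closed)

text \<open>
  Taking the measure of an image under an iterate is taking the measure of a preimage under the opposite
  iterate. So \<open>iterate_measure M f n\<close> is a push-forward, and integrals against it are computed
  by substitution.
\<close>
lemma iterate_measure_eq_distr: "iterate_measure M f n = distr M M (g (- n))"
  unfolding iterate_measure_def distr_def
  by (rule measure_of_eq)
     (auto simp: sets.space_closed sets.sigma_sets_eq g_image_eq_vimage dest: sets.sets_into_space)

lemma nn_integral_density_iterate:
  assumes [measurable]: "F \<in> borel_measurable M"
    and dens: "density M h = iterate_measure M f n" and [measurable]: "h \<in> borel_measurable M"
  shows "(\<integral>\<^sup>+x. h x * F x \<partial>M) = (\<integral>\<^sup>+x. F (g (- n) x) \<partial>M)"
proof -
  have "(\<integral>\<^sup>+x. h x * F x \<partial>M) = (\<integral>\<^sup>+x. F x \<partial>density M h)"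
    by (simp add: nn_integral_density)
  also have "\<dots> = (\<integral>\<^sup>+x. F (g (- n) x) \<partial>M)"
    by (simp add: dens iterate_measure_eq_distr nn_integral_distr)
  finally show ?thesis .
qed

lemma density_RN_1: "density M (RN 1) = iterate_measure M f 1"
  using density_exists by (auto intro: RN_derivI)

text \<open>
  The two bounds on the derivative of \<open>\<mu> f\<close> say that composition with \<open>f\<close> and with its inverse enlarges
  integrals at most by the factors \<open>1 / c\<close> and \<open>C\<close>. Such bounds multiply under composition of maps, so
  every iterate has one.
\<close>
lemma nn_integral_g_le:
  "\<exists>K\<ge>0. \<forall>F \<in> borel_measurable M. (\<integral>\<^sup>+x. F (g n x) \<partial>M) \<le> ennreal K * (\<integral>\<^sup>+x. F x \<partial>M)"
proof -
  let ?P = "\<lambda>n. \<exists>K\<ge>0. \<forall>F \<in> borel_measurable M. (\<integral>\<^sup>+x. F (g n x) \<partial>M) \<le> ennreal K * (\<integral>\<^sup>+x. F x \<partial>M)"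
  have RN_F: "(\<integral>\<^sup>+x. RN 1 x * F x \<partial>M) = (\<integral>\<^sup>+x. F (g (- 1) x) \<partial>M)"
    if "F \<in> borel_measurable M" for F
    using that by (intro nn_integral_density_iterate density_RN_1) auto
  have zero: "?P 0" by (auto simp: g_0 intro!: exI [of _ 1])
  have minus_one: "?P (- 1)"
  \<comment> \<open>The maximum makes the constant nonnegative.\<close>
  proof (intro exI [of _ "max 0 C"] conjI ballI)
    fix F :: "'a \<Rightarrow> ennreal" assume [measurable]: "F \<in> borel_measurable M"
    have "(\<integral>\<^sup>+x. F (g (- 1) x) \<partial>M) = (\<integral>\<^sup>+x. RN 1 x * F x \<partial>M)" by (simp add: RN_F)
    also have "\<dots> \<le> (\<integral>\<^sup>+x. ennreal (max 0 C) * F x \<partial>M)"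
    proof (rule nn_integral_mono_AE)
      show "AE x in M. RN 1 x * F x \<le> ennreal (max 0 C) * F x"
        using RN_bounds by eventually_elim
          (auto intro!: mult_right_mono elim: order_trans intro: ennreal_leI)
    qed
    also have "\<dots> = ennreal (max 0 C) * (\<integral>\<^sup>+x. F x \<partial>M)" by (simp add: nn_integral_cmult)
    finally show "(\<integral>\<^sup>+x. F (g (- 1) x) \<partial>M) \<le> ennreal (max 0 C) * (\<integral>\<^sup>+x. F x \<partial>M)" .
  qed auto
  have one: "?P 1"
  proof (intro exI [of _ "1 / c"] conjI ballI)
    fix F :: "'a \<Rightarrow> ennreal" assume [measurable]: "F \<in> borel_measurable M"
    have "(\<integral>\<^sup>+x. F (g 1 x) \<partial>M) = ennreal (1 / c) * (\<integral>\<^sup>+x. ennreal c * F (g 1 x) \<partial>M)"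
      using c_pos by (simp add: nn_integral_cmult mult.assoc [symmetric] ennreal_mult [symmetric])
    also have "\<dots> \<le> ennreal (1 / c) * (\<integral>\<^sup>+x. RN 1 x * F (g 1 x) \<partial>M)"
    proof (intro mult_left_mono nn_integral_mono_AE)
      show "AE x in M. ennreal c * F (g 1 x) \<le> RN 1 x * F (g 1 x)"
        using RN_bounds by eventually_elim (auto intro: mult_right_mono)
    qed auto
    also have "(\<integral>\<^sup>+x. RN 1 x * F (g 1 x) \<partial>M) = (\<integral>\<^sup>+x. F (g 1 (g (- 1) x)) \<partial>M)"
      by (rule RN_F) measurable
    also have "\<dots> = (\<integral>\<^sup>+x. F x \<partial>M)"
      by (rule nn_integral_cong) (simp add: g_inverse)
    finally show "(\<integral>\<^sup>+x. F (g 1 x) \<partial>M) \<le> ennreal (1 / c) * (\<integral>\<^sup>+x. F x \<partial>M)" .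
  qed (use c_pos in auto)
  have add: "?P (m + n)" if m: "?P m" and n: "?P n" for m n
  proof -
    obtain K where K: "0 \<le> K" "\<And>F. F \<in> borel_measurable M \<Longrightarrow>
        (\<integral>\<^sup>+x. F (g m x) \<partial>M) \<le> ennreal K * (\<integral>\<^sup>+x. F x \<partial>M)" using m by blast
    obtain L where L: "0 \<le> L" "\<And>F. F \<in> borel_measurable M \<Longrightarrow>
        (\<integral>\<^sup>+x. F (g n x) \<partial>M) \<le> ennreal L * (\<integral>\<^sup>+x. F x \<partial>M)" using n by blast
    show ?thesis
    proof (intro exI [of _ "L * K"] conjI ballI)
      fix F :: "'a \<Rightarrow> ennreal" assume [measurable]: "F \<in> borel_measurable M"
      have "(\<integral>\<^sup>+x. F (g (m + n) x) \<partial>M) = (\<integral>\<^sup>+x. F (g m (g n x)) \<partial>M)"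
        by (rule nn_integral_cong) (simp add: g_add)
      also have "\<dots> \<le> ennreal L * (\<integral>\<^sup>+x. F (g m x) \<partial>M)"
        by (rule L(2)) measurable
      also have "\<dots> \<le> ennreal L * (ennreal K * (\<integral>\<^sup>+x. F x \<partial>M))"
        by (intro mult_left_mono K(2)) auto
      finally show "(\<integral>\<^sup>+x. F (g (m + n) x) \<partial>M) \<le> ennreal (L * K) * (\<integral>\<^sup>+x. F x \<partial>M)"
        using K(1) L(1) by (simp add: ennreal_mult mult.assoc)
    qed (use K L in auto)
  qed
  show ?thesis
  proof (induction n rule: int_induct [where k = 0])
    case base
    show ?case by (rule zero)
  next
    case (step1 i)
    show ?case by (rule add [OF step1(2) one])
  next
    case (step2 i)
    show ?case using add [OF step2(2) minus_one] by simp
  qed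
qed

text \<open>
  The Radon-Nikodym theorem now provides a density for every iterate, not only for the first one.
\<close>
lemma iterate_measure_abs_cont: "absolutely_continuous M (iterate_measure M f n)"
  unfolding absolutely_continuous_def iterate_measure_eq_distr
proof
  fix A assume A: "A \<in> null_sets M"
  then have [measurable]: "A \<in> sets M" by auto
  obtain K where K: "\<And>F. F \<in> borel_measurable M \<Longrightarrow>
      (\<integral>\<^sup>+x. F (g (- n) x) \<partial>M) \<le> ennreal K * (\<integral>\<^sup>+x. F x \<partial>M)"
    using nn_integral_g_le [of "- n"] by blast
  have "emeasure (distr M M (g (- n))) A = (\<integral>\<^sup>+x. indicator A x \<partial>distr M M (g (- n)))"
    by simp
  also have "\<dots> = (\<integral>\<^sup>+x. indicator A (g (- n) x) \<partial>M)"
    by (rule nn_integral_distr) auto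
  also have "\<dots> \<le> ennreal K * (\<integral>\<^sup>+x. indicator A x \<partial>M)" by (rule K) simp
  also have "\<dots> = 0" using A by (simp add: null_setsD1)
  finally show "A \<in> null_sets (distr M M (g (- n)))" by (auto simp: null_sets_def)
qed

lemma AE_g:
  assumes "AE x in M. P x"
  shows "AE x in M. P (g n x)"
proof (rule AE_distrD [OF g_measurable])
  have "AE x in iterate_measure M f (- n). P x"
    by (rule absolutely_continuous_AE [OF _ iterate_measure_abs_cont assms])
       (simp add: iterate_measure_eq_distr)
  then show "AE x in distr M M (g n). P x"
    unfolding iterate_measure_eq_distr minus_minus .
qed

lemma density_RN: "density M (RN n) = iterate_measure M f n"
  by (rule density_RN_deriv [OF iterate_measure_abs_cont]) (simp add: iterate_measure_eq_distr)

text \<open>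
  The weight in the norm of the sequence space is exactly the Jacobian of the substitution that moves
  \<open>W\<close> to its \<open>n\<close>-th image.
\<close>
lemma nn_integral_iterate_on_W:
  assumes [measurable]: "F \<in> borel_measurable M"
  shows "(\<integral>\<^sup>+x\<in>W. F (g n x) * RN n x \<partial>M) = (\<integral>\<^sup>+x\<in>g n ` W. F x \<partial>M)"
proof -
  have "(\<integral>\<^sup>+x\<in>W. F (g n x) * RN n x \<partial>M) = (\<integral>\<^sup>+x. RN n x * (F (g n x) * indicator W x) \<partial>M)"
    by (simp add: mult_ac)
  also have "\<dots> = (\<integral>\<^sup>+x. F (g n (g (- n) x)) * indicator W (g (- n) x) \<partial>M)"
    by (rule nn_integral_density_iterate [OF _ density_RN]) measurable
  also have "\<dots> = (\<integral>\<^sup>+x\<in>g n ` W. F x \<partial>M)"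
    using sets.sets_into_space [OF W]
    by (intro nn_integral_cong) (simp add: g_inverse g_image_eq_vimage indicator_def)
  finally show ?thesis .
qed

lemma g_image_sets [measurable]: "g n ` W \<in> sets M"
  using sets.sets_into_space [OF W] by (simp add: g_image_eq_vimage)

lemma nn_integral_eq_infsum_orbit:
  assumes [measurable]: "F \<in> borel_measurable M"
  shows "(\<integral>\<^sup>+x. F x \<partial>M) = (\<Sum>\<^sub>\<infinity>n\<in>UNIV. \<integral>\<^sup>+x\<in>g n ` W. F x \<partial>M)"
proof -
  let ?I = "\<lambda>n. \<integral>\<^sup>+x\<in>g n ` W. F x \<partial>M"
  have disj: "disjoint_family (\<lambda>k. g (int_decode k) ` W)"
    using disjoint by (simp add: disjoint_family_on_def inj_eq [OF inj_int_decode])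
  have "(\<Sum>\<^sub>\<infinity>n\<in>UNIV. ?I n) = (\<Sum>\<^sub>\<infinity>k\<in>UNIV. ?I (int_decode k))"
    by (rule infsum_reindex_bij_betw [OF bij_int_decode, symmetric])
  also have "\<dots> = (\<Sum>k. ?I (int_decode k))"
    by (rule sums_unique [OF has_sum_imp_sums [OF has_sum_infsum]])
       (simp add: nonneg_summable_on_complete)
  also have "\<dots> = (\<integral>\<^sup>+x. (\<Sum>k. F x * indicator (g (int_decode k) ` W) x) \<partial>M)"
    by (rule nn_integral_suminf [symmetric]) measurable
  also have "\<dots> = (\<integral>\<^sup>+x. F x \<partial>M)"
  proof (rule nn_integral_cong)
    fix x assume "x \<in> space M"
    then obtain n where "x \<in> g n ` W" using cover by blast
    then have "x \<in> g (int_decode (int_encode n)) ` W" by simp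
    then show "(\<Sum>k. F x * indicator (g (int_decode k) ` W) x) = F x"
      by (rule suminf_cmult_indicator [OF disj])
  qed
  finally show ?thesis by simp
qed

text \<open>
  The source of the isometry: an integral over the whole space is the sum of the integrals over the images
  of \<open>W\<close>, each of them pulled back to \<open>W\<close>.
\<close>
lemma Lp_energy_eq_infsum_W:
  fixes u :: "'a \<Rightarrow> 'k::{banach, second_countable_topology}"
  assumes [measurable]: "u \<in> borel_measurable M"
  shows "Lp_energy M p u
    = (\<Sum>\<^sub>\<infinity>n\<in>UNIV. \<integral>\<^sup>+x\<in>W. ennreal (norm (u (g n x)) powr p) * RN n x \<partial>M)"
proof -
  have "(\<lambda>x. ennreal (norm (u x) powr p)) \<in> borel_measurable M" by measurable
  from nn_integral_eq_infsum_orbit [OF this] nn_integral_iterate_on_W [OF this]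
  show ?thesis by (simp add: Lp_energy_def)
qed

lemma AE_restrict_W: "(AE x in M\<^sub>W. P x) \<longleftrightarrow> (AE x in M. x \<in> W \<longrightarrow> P x)"
  by (rule AE_restrict_space_iff) simp

lemma B_sum_eq_Lp_energy:
  fixes u :: "'a \<Rightarrow> 'k::{banach, second_countable_topology}"
  assumes u: "u \<in> borel_measurable M"
    and v: "\<And>n. v n \<in> Lp_fun M\<^sub>W p"
    and eq: "\<And>n. AE x in M\<^sub>W. v n x = u (g n x)"
  shows "B_sum M p f W (\<lambda>n. Lp_class M\<^sub>W p (v n)) = Lp_energy M p u"
  unfolding B_sum_def Lp_energy_eq_infsum_W [OF u]
proof (rule infsum_cong, rule nn_integral_cong_AE)
  fix n :: int
  show "AE x in M. ennreal (norm (Lp_rep (Lp_class M\<^sub>W p (v n)) x) powr p) * RN n x * indicator W x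
      = ennreal (norm (u (g n x)) powr p) * RN n x * indicator W x"
    using Lp_rep_class_AE [OF v [of n], unfolded AE_restrict_W] eq [of n, unfolded AE_restrict_W]
    by eventually_elim (auto simp: indicator_def)
qed

lemma Lp_energy_g_le:
  "\<exists>K\<ge>0. \<forall>u \<in> borel_measurable M.
    Lp_energy M p (\<lambda>x. u (g n x) :: 'k::{banach, second_countable_topology}) \<le> ennreal K * Lp_energy M p u"
proof -
  obtain K where K: "0 \<le> K" "\<And>F. F \<in> borel_measurable M \<Longrightarrow>
      (\<integral>\<^sup>+x. F (g n x) \<partial>M) \<le> ennreal K * (\<integral>\<^sup>+x. F x \<partial>M)"
    using nn_integral_g_le [of n] by blast
  show ?thesis
    using K(1) K(2) [of "\<lambda>x. ennreal (norm (u x :: 'k) powr p)" for u]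
    by (intro exI [of _ K]) (auto simp: Lp_energy_def)
qed

text \<open>
  The factor in the preceding estimate may grow with \<open>n\<close>. One finite factor for each \<open>n\<close> is enough to
  place the components of the sequence attached to a function in the unweighted space over \<open>W\<close>.
\<close>
lemma Lp_fun_g:
  fixes u :: "'a \<Rightarrow> 'k::{banach, second_countable_topology}"
  assumes "u \<in> Lp_fun M p"
  shows "(\<lambda>x. u (g n x)) \<in> Lp_fun M p"
proof -
  have [measurable]: "u \<in> borel_measurable M" and fin: "Lp_energy M p u < \<infinity>"
    using assms by (auto simp: Lp_fun_iff)
  obtain K where "0 \<le> K" "Lp_energy M p (\<lambda>x. u (g n x)) \<le> ennreal K * Lp_energy M p u"
    using Lp_energy_g_le [of p n, where ?'k = 'k] by force
  then have "Lp_energy M p (\<lambda>x. u (g n x)) < \<infinity>"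
    using fin by (auto intro: le_less_trans simp: ennreal_mult_less_top)
  then show ?thesis by (simp add: Lp_fun_iff)
qed

lemma Lp_fun_restrict_W:
  fixes u :: "'a \<Rightarrow> 'k::{banach, second_countable_topology}"
  assumes "u \<in> Lp_fun M p"
  shows "u \<in> Lp_fun M\<^sub>W p"
proof -
  have "Lp_energy M\<^sub>W p u \<le> Lp_energy M p u"
    unfolding Lp_energy_def
    by (subst nn_integral_restrict_space) (auto intro!: nn_integral_mono simp: indicator_def)
  then show ?thesis
    using assms by (auto simp: Lp_fun_iff intro: measurable_restrict_space1 le_less_trans)
qed

lemma composition_op_class:
  fixes u :: "'a \<Rightarrow> 'k::{banach, second_countable_topology}"
  assumes u: "u \<in> Lp_fun M p"
  shows "composition_op M p f (Lp_class M p u) = Lp_class M p (\<lambda>x. u (f x))"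
  unfolding composition_op_def comp_def
  using AE_g [OF Lp_rep_class_AE [OF u], of 1] Lp_fun_g [OF u, of 1]
    Lp_fun_g [OF Lp_rep_class_mem [OF u], of 1]
  by (simp add: Lp_class_eq_iff g_1)

lemma bounded_linear_composition_op:
  assumes p: "1 \<le> p"
  shows "bounded_linear_on (Lp_space M p ::
    ('k::{real_normed_field, banach, second_countable_topology}, ('a \<Rightarrow> 'k) set) normed_module)
    (Lp_space M p) (composition_op M p f)"
    (is "bounded_linear_on ?L _ ?T")
proof -
  have uf: "(\<lambda>x. u (f x)) \<in> Lp_fun M p" if "u \<in> Lp_fun M p" for u :: "'a \<Rightarrow> 'k"
    using Lp_fun_g [OF that, of 1] by (simp add: g_1)
  note simps = composition_op_class uf Lp_class_in_carrier Lp_space_add [OF p] Lp_space_smult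
    Lp_fun_add(1) [OF p] Lp_fun_scale Lp_space_vnorm
  obtain K where K: "0 \<le> K" "\<And>u :: 'a \<Rightarrow> 'k. u \<in> borel_measurable M \<Longrightarrow>
      Lp_energy M p (\<lambda>x. u (f x)) \<le> ennreal K * Lp_energy M p u"
    using Lp_energy_g_le [of p 1, where ?'k = 'k] by (auto simp: g_1)
  have le: "Lp_norm M p (\<lambda>x. u (f x)) \<le> K powr (1 / p) * Lp_norm M p u"
    if u: "u \<in> Lp_fun M p" for u :: "'a \<Rightarrow> 'k"
  proof -
    have "enn2real (Lp_energy M p (\<lambda>x. u (f x))) \<le> enn2real (ennreal K * Lp_energy M p u)"
      using u K by (intro enn2real_mono) (auto simp: Lp_fun_iff ennreal_mult_less_top)
    also have "\<dots> = K * enn2real (Lp_energy M p u)" using K(1) by (simp add: enn2real_mult)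
    finally show ?thesis
      using p K(1) by (simp add: Lp_norm_def powr_mult [symmetric] powr_mono2)
  qed
  show ?thesis
    unfolding bounded_linear_on_def
  proof (intro conjI ballI allI exI [of _ "K powr (1 / p)"])
    fix x assume "x \<in> carrier ?L"
    then show "?T x \<in> carrier ?L" "vnorm ?L (?T x) \<le> K powr (1 / p) * vnorm ?L x"
      "?T (a \<odot>\<^bsub>?L\<^esub> x) = a \<odot>\<^bsub>?L\<^esub> ?T x" for a
      by (auto elim!: Lp_space_carrierE simp: simps le)
    fix y assume "y \<in> carrier ?L"
    with \<open>x \<in> carrier ?L\<close> show "?T (x \<oplus>\<^bsub>?L\<^esub> y) = ?T x \<oplus>\<^bsub>?L\<^esub> ?T y"
      by (auto elim!: Lp_space_carrierE simp: simps)
  qed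
qed

text \<open>
  The conjugating map: it records a function on the orbit images of \<open>W\<close>, each of them
  parametrised by \<open>W\<close> itself.
\<close>
definition to_sequence :: "real \<Rightarrow> ('a \<Rightarrow> 'k::{banach, second_countable_topology}) set
    \<Rightarrow> int \<Rightarrow> ('a \<Rightarrow> 'k) set" where
  "to_sequence p A = (\<lambda>n. Lp_class M\<^sub>W p (\<lambda>x. Lp_rep A (g n x)))"

lemma Lp_fun_g_W:
  fixes u :: "'a \<Rightarrow> 'k::{banach, second_countable_topology}"
  shows "u \<in> Lp_fun M p \<Longrightarrow> (\<lambda>x. u (g n x)) \<in> Lp_fun M\<^sub>W p"
  by (intro Lp_fun_restrict_W Lp_fun_g)

lemma to_sequence_class:
  fixes u :: "'a \<Rightarrow> 'k::{banach, second_countable_topology}"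
  assumes u: "u \<in> Lp_fun M p"
  shows "to_sequence p (Lp_class M p u) = (\<lambda>n. Lp_class M\<^sub>W p (\<lambda>x. u (g n x)))"
proof
  fix n
  show "to_sequence p (Lp_class M p u) n = Lp_class M\<^sub>W p (\<lambda>x. u (g n x))"
    using AE_g [OF Lp_rep_class_AE [OF u], of n]
    by (auto simp: to_sequence_def Lp_class_eq_iff Lp_fun_g_W u Lp_rep_class_mem AE_restrict_W)
qed

lemma B_sum_to_sequence:
  fixes u :: "'a \<Rightarrow> 'k::{banach, second_countable_topology}"
  assumes u: "u \<in> Lp_fun M p"
  shows "B_sum M p f W (to_sequence p (Lp_class M p u)) = Lp_energy M p u"
  using u unfolding to_sequence_class [OF u]
  by (intro B_sum_eq_Lp_energy Lp_fun_g_W) (auto simp: Lp_fun_iff)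

text \<open>
  Equality almost everywhere on \<open>W\<close> is transported to the \<open>n\<close>-th image because the iterates preserve null
  sets; countably many images cover the space.
\<close>
lemma to_sequence_class_eqD:
  fixes u v :: "'a \<Rightarrow> 'k::{banach, second_countable_topology}"
  assumes u: "u \<in> Lp_fun M p" and v: "v \<in> Lp_fun M p"
    and eq: "to_sequence p (Lp_class M p u) = to_sequence p (Lp_class M p v)"
  shows "Lp_class M p u = Lp_class M p v"
proof -
  have "AE x in M. g (- n) x \<in> W \<longrightarrow> u x = v x" for n
  proof -
    have "Lp_class M\<^sub>W p (\<lambda>x. u (g n x)) = Lp_class M\<^sub>W p (\<lambda>x. v (g n x))"
      using fun_cong [OF eq, of n] by (simp add: to_sequence_class u v)
    then have "AE x in M. x \<in> W \<longrightarrow> u (g n x) = v (g n x)"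
      by (simp add: Lp_class_eq_iff Lp_fun_g_W u v AE_restrict_W)
    from AE_g [OF this, of "- n"] AE_space show ?thesis
      by eventually_elim (simp add: g_inverse)
  qed
  then have "AE x in M. \<forall>n. g (- n) x \<in> W \<longrightarrow> u x = v x"
    unfolding AE_all_countable by blast
  then have "AE x in M. u x = v x"
    using AE_space
  proof eventually_elim
    fix x assume *: "\<forall>n. g (- n) x \<in> W \<longrightarrow> u x = v x" and "x \<in> space M"
    then obtain n where "x \<in> g n ` W" using cover by blast
    then have "g (- n) x \<in> W"
      using sets.sets_into_space [OF W] by (auto simp: g_inverse)
    then show "u x = v x" using * by blast
  qed
  then show ?thesis by (simp add: Lp_class_eq_iff u v)
qed

text \<open>
  Each point lies in exactly one image of \<open>W\<close>; the function that gives the index of that image is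
  measurable, and countably many measurable pieces glue to a measurable function.
\<close>
lemma glue_along_orbit:
  fixes w :: "int \<Rightarrow> 'a \<Rightarrow> 'k::{banach, second_countable_topology}"
  assumes w: "\<And>n. w n \<in> borel_measurable M\<^sub>W"
  obtains u where "u \<in> borel_measurable M" "\<And>n x. x \<in> W \<Longrightarrow> u (g n x) = w n x"
proof -
  define ix where "ix x = (THE n. x \<in> g n ` W)" for x
  have ix: "ix x = n" if "x \<in> g n ` W" for x n
    unfolding ix_def using that disjoint
    by (intro the_equality) (auto simp: disjoint_family_on_def)
  have [measurable]: "ix \<in> measurable M (count_space UNIV)"
  proof (subst measurable_count_space_eq_countable, simp, intro conjI allI ballI)
    fix n :: int
    have "ix -` {n} \<inter> space M = g n ` W"
      using ix cover sets.sets_into_space [OF g_image_sets] by fast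
    then show "ix -` {n} \<inter> space M \<in> sets M" by simp
  qed auto
  \<comment> \<open>Values outside \<open>W\<close> are replaced by \<open>0\<close> to get a function measurable on the whole space.\<close>
  define v where "v n x = (if x \<in> W then w n x else 0)" for n x
  have [measurable]: "v n \<in> borel_measurable M" for n
    using w [of n] unfolding v_def [abs_def]
    by (subst (asm) measurable_restrict_space_iff [of W M 0]) auto
  define u where "u x = v (ix x) (g (- ix x) x)" for x
  have "u \<in> borel_measurable M"
    unfolding u_def [abs_def]
    by (rule measurable_compose_countable [where f = "\<lambda>i x. v i (g (- i) x)"]) measurable
  moreover have "u (g n x) = w n x" if "x \<in> W" for n x
    using ix [of "g n x" n] that sets.sets_into_space [OF W]
    by (auto simp: u_def v_def g_inverse)
  ultimately show ?thesis using that by blast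
qed

text \<open>
  Surjectivity: representatives of the components of a sequence glue to a measurable function, and the
  energy identity turns finiteness of the sequence norm into membership in the \<open>L\<^sup>p\<close> space.
\<close>
lemma bij_betw_to_sequence:
  "bij_betw (to_sequence p) (carrier (Lp_space M p))
    (carrier (B_space M p f W :: ('k::{real_normed_field, banach, second_countable_topology}, _) normed_module))"
  (is "bij_betw ?H (carrier ?L) (carrier ?B)")
  unfolding bij_betw_def
proof
  show "inj_on ?H (carrier ?L)"
    by (rule inj_onI) (auto elim!: Lp_space_carrierE dest: to_sequence_class_eqD)
  have B: "\<psi> \<in> carrier ?B \<longleftrightarrow> (\<forall>n. \<psi> n \<in> carrier (Lp_space M\<^sub>W p)) \<and> B_sum M p f W \<psi> < \<infinity>"
    for \<psi> :: "int \<Rightarrow> ('a \<Rightarrow> 'k) set"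
    by (simp add: B_space_def Let_def)
  show "?H ` carrier ?L = carrier ?B"
  proof (intro equalityI subsetI)
    fix \<psi> assume "\<psi> \<in> ?H ` carrier ?L"
    then obtain u :: "'a \<Rightarrow> 'k" where u: "u \<in> Lp_fun M p" and \<psi>: "\<psi> = ?H (Lp_class M p u)"
      by (auto elim!: Lp_space_carrierE)
    show "\<psi> \<in> carrier ?B"
      unfolding B \<psi> B_sum_to_sequence [OF u]
      using u by (auto simp: to_sequence_class [OF u] Lp_fun_iff [of u]
          intro!: Lp_class_in_carrier Lp_fun_g_W)
  next
    fix \<psi> assume \<psi>: "\<psi> \<in> carrier ?B"
    have "\<forall>n. \<exists>w. w \<in> Lp_fun M\<^sub>W p \<and> \<psi> n = Lp_class M\<^sub>W p w"
      using \<psi> unfolding B by (meson Lp_space_carrierE)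
    then obtain w where w: "\<And>n. w n \<in> Lp_fun M\<^sub>W p" "\<And>n. \<psi> n = Lp_class M\<^sub>W p (w n)"
      by (auto dest!: choice)
    then have "w n \<in> borel_measurable M\<^sub>W" for n by (auto simp: Lp_fun_iff)
    then obtain u where u: "u \<in> borel_measurable M" "\<And>n x. x \<in> W \<Longrightarrow> u (g n x) = w n x"
      using glue_along_orbit by blast
    have AE: "AE x in M\<^sub>W. w n x = u (g n x)" for n
      by (simp add: AE_restrict_W u(2))
    have "B_sum M p f W \<psi> = Lp_energy M p u"
      using B_sum_eq_Lp_energy [OF u(1) w(1) AE] by (simp add: w(2) [symmetric])
    then have mem: "u \<in> Lp_fun M p" using \<psi> u(1) unfolding B by (simp add: Lp_fun_iff)
    have "?H (Lp_class M p u) = \<psi>"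
      unfolding to_sequence_class [OF mem] using AE
      by (auto simp: fun_eq_iff w Lp_class_eq_iff Lp_fun_g_W mem AE_restrict_W u(2))
    then show "\<psi> \<in> ?H ` carrier ?L" using Lp_class_in_carrier [OF mem] by blast
  qed
qed

text \<open>
  Since \<open>f\<close> after the \<open>n\<close>-th iterate is the iterate with index \<open>n + 1\<close>, the component of
  \<open>u \<circ> f\<close> at \<open>n\<close> is the component of \<open>u\<close> at \<open>n + 1\<close>: this is the intertwining relation.
\<close>
theorem composition_op_conjugate_shift:
  assumes p: "1 \<le> p"
  shows "conjugate_operators
    (Lp_space M p :: ('k::{real_normed_field, banach, second_countable_topology}, ('a \<Rightarrow> 'k) set) normed_module)
    (composition_op M p f) (B_space M p f W) (shift_op (\<lambda>n. id))"
    (is "conjugate_operators ?L ?T ?B ?S")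
proof (rule conjugate_operators_of_isometry [where H = "to_sequence p"])
  note simps = to_sequence_class Lp_fun_g_W B_space_def Let_def
    Lp_space_add [OF p] Lp_space_smult Lp_space_zero Lp_fun_add(1) [OF p] Lp_fun_scale Lp_fun_zero
  show "banach_space_on ?L" by (rule banach_space_on_Lp_space [OF p])
  show "bounded_linear_on ?L ?L ?T" by (rule bounded_linear_composition_op [OF p])
  show "bij_betw (to_sequence p) (carrier ?L) (carrier ?B)" by (rule bij_betw_to_sequence)
  show "to_sequence p \<zero>\<^bsub>?L\<^esub> = \<zero>\<^bsub>?B\<^esub>" using p by (simp add: simps)
  fix x assume "x \<in> carrier ?L"
  then obtain u where u: "u \<in> Lp_fun M p" and x: "x = Lp_class M p u" by (rule Lp_space_carrierE)
  show "to_sequence p (a \<odot>\<^bsub>?L\<^esub> x) = a \<odot>\<^bsub>?B\<^esub> to_sequence p x" for a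
    using u by (simp add: x simps)
  show "vnorm ?B (to_sequence p x) = vnorm ?L x"
    using u by (simp add: x B_space_def Let_def B_sum_to_sequence Lp_space_vnorm Lp_norm_def)
  show "to_sequence p (?T x) = ?S (to_sequence p x)"
  proof
    fix n
    have uf: "(\<lambda>x. u (f x)) \<in> Lp_fun M p" using Lp_fun_g [OF u, of 1] by (simp add: g_1)
    have "Lp_class M\<^sub>W p (\<lambda>x. u (f (g n x))) = Lp_class M\<^sub>W p (\<lambda>x. u (g (n + 1) x))"
      using Lp_fun_g_W [OF uf] Lp_fun_g_W [OF u] sets.sets_into_space [OF W]
      by (auto simp: Lp_class_eq_iff AE_restrict_W g_succ)
    then show "to_sequence p (?T x) n = ?S (to_sequence p x) n"
      using u uf by (simp add: x composition_op_class to_sequence_class shift_op_def)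
  qed
  fix y assume "y \<in> carrier ?L"
  then show "to_sequence p (x \<oplus>\<^bsub>?L\<^esub> y) = to_sequence p x \<oplus>\<^bsub>?B\<^esub> to_sequence p y"
    using u by (auto elim!: Lp_space_carrierE simp: x simps)
qed

end

theorem theorem2p4:
  fixes M :: "'a measure" and p :: real and f :: "'a \<Rightarrow> 'a" and W :: "'a set"
    and c C :: real
  assumes "sigma_finite_measure M"
    and "1 \<le> p"
    and "bij_betw f (space M) (space M)"
    and "f \<in> measurable M M"
    and "\<And>A. A \<in> sets M \<Longrightarrow> f ` A \<in> sets M"
    and "\<exists>h \<in> borel_measurable M. density M h = iterate_measure M f 1"
    and "0 < c"
    and "AE x in M. ennreal c \<le> RN_deriv M (iterate_measure M f 1) x
                  \<and> RN_deriv M (iterate_measure M f 1) x \<le> ennreal C"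
    and "W \<in> sets M" and "0 < emeasure M W" and "emeasure M W < \<infinity>"
    and "disjoint_family (\<lambda>k::int. int_iterate M f k ` W)"
    and "(\<Union>k::int. int_iterate M f k ` W) = space M"
  shows "conjugate_operators
           (Lp_space M p ::
             ('k::{real_normed_field, banach, second_countable_topology}, ('a \<Rightarrow> 'k) set) normed_module)
           (composition_op M p f)
           (B_space M p f W)
           (shift_op (\<lambda>n. id))"
proof -
  interpret dissipative_system M f W c C
    by (intro dissipative_system.intro dissipative_system_axioms.intro) fact+
  show ?thesis by (rule composition_op_conjugate_shift) fact
qed

end
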